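(* Suppose that the basis functions $\boldsymbol{\varphi}_1,\dots,\boldsymbol{\varphi}_K$ have the following three properties. First, each $\boldsymbol{\varphi}_j$ is continuously differentiable and (locally) Lipschitz continuous in the following sense: there are constants $L_{\varphi_j}>0$ such that for all $j\in[K]$ and $y\in\mathbb{R}^2$ there is $\tilde L>0$ with $\|\boldsymbol{\varphi}_j(y)-\boldsymbol{\varphi}_j(\tilde y)\|_2\le L_{\varphi_j}\|y-\tilde y\|_2$ for all $\tilde y\in B_{\tilde L}(y)=\{\tilde y\in\mathbb{R}^2:\|\tilde y-y\|_2^2<\tilde L\}$. Second, there are vectors $c_{\varphi_j},C_{\varphi_j}\in\mathbb{R}^2$ with only positive entries, $c_{\varphi_j}<C_{\varphi_j}$, such that $c_{\varphi_j}\le\boldsymbol{\varphi}_j(y)\le C_{\varphi_j}$ for all $j\in[K]$, $y\in\mathbb{R}^2$. Third, $(\boldsymbol{\varphi}_j(y)-\boldsymbol{\varphi}_j(\tilde y))\cdot(y-\tilde y)\ge 0$ for all $y,\tilde y\in\mathbb{R}^2$, $j\in[K]$. Suppose moreover that, for each $\boldsymbol{\alpha}\in\mathscr{A}_K$, $\boldsymbol{g}=\boldsymbol{g}_{\boldsymbol{\alpha}}\in C^1(\mathbb{R}^2;\mathbb{R}^2)$ and its Jacobian matrix $\nabla\boldsymbol{g}(y)\in\mathbb{R}^{2\times2}$ is positive semi-definite (i.e. $z^\top\nabla\boldsymbol{g}(y)z\ge0$ for all $z\in\mathbb{R}^2$) for all $y\in\mathbb{R}^2$. Let $\boldsymbol{\varepsilon}\in\mathscr{E}_{\mathrm{ad}}$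 be fixed and let $k\in[K]$. Then there is a constant $C>0$, independent of $\boldsymbol{g}_{\boldsymbol{\alpha}^1},\boldsymbol{g}_{\boldsymbol{\alpha}^2},\boldsymbol{\alpha}^1$ and $\boldsymbol{\alpha}^2$, such that for all $\boldsymbol{\alpha}^1,\boldsymbol{\alpha}^2\in\mathscr{A}_k$ the difference of the two corresponding solutions satisfies $$\|\boldsymbol{y}^{\boldsymbol{\alpha}^1}-\boldsymbol{y}^{\boldsymbol{\alpha}^2}\|_{\mathscr{Y}}\le C\,k^2\,\|\boldsymbol{\alpha}^1-\boldsymbol{\alpha}^2\|_\infty .$$
   Context: For $n\in\mathbb{N}$, $[n]=\{1,\dots,n\}$. Comparisons of vectors are componentwise. $\Omega\subsetneq\mathbb{R}^2$ is a bounded convex domain with Lipschitz-continuous boundary $\Gamma=\partial\Omega$. $\mathbb{L}^2(\Omega)=L^2(\Omega)\times L^2(\Omega)$, $\mathbb{H}^2(\Omega)=H^2(\Omega)\times H^2(\Omega)$, $\mathbb{H}^1_0(\Omega)=H^1_0(\Omega)\times H^1_0(\Omega)$ with norm $\|\boldsymbol{v}\|_{\mathbb{H}^1_0(\Omega)}=\|\nabla\boldsymbol{v}\|_{\mathbb{L}^2(\Omega)}$. $\mathscr{Y}=\mathbb{H}^2(\Omega)\cap\mathbb{H}^1_0(\Omega)$ with norm $\|\boldsymbol{v}\|_{\mathscr{Y}}=\|\Delta\boldsymbol{v}\|_{\mathbb{L}^2(\Omega)}$. Admissible controls: $\mathscr{E}_{\mathrm{ad}}=\{\boldsymbol{\varepsilon}\in\mathbb{L}^2(\Omega):\boldsymbol{\varepsilon}_{\mathsf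 a}\le\boldsymbol{\varepsilon}(x)\le\boldsymbol{\varepsilon}_{\mathsf b}\text{ for a.a. }x\in\Omega\}$ for given $\boldsymbol{\varepsilon}_{\mathsf a}\le\boldsymbol{\varepsilon}_{\mathsf b}$ in $\mathbb{R}^2$. $\boldsymbol{\varphi}_1,\dots,\boldsymbol{\varphi}_K:\mathbb{R}^2\to\mathbb{R}^2$ is a basis of a $K$-dimensional space of functions. $\boldsymbol{g}_{\boldsymbol{\alpha}}(y)=\sum_{j=1}^K\alpha_j\boldsymbol{\varphi}_j(y)$; $\alpha_{\max}\ge0$ is a fixed scalar and $\mathscr{A}_K=\{\boldsymbol{\alpha}\in\mathbb{R}^K:0\le\alpha_i\le\alpha_{\max}\text{ for }i\in[K]\}$. For $1\le k\le K-1$, $\mathscr{A}_k=\{\boldsymbol{\alpha}\in\mathscr{A}_K:\alpha_j=0,\ j=k+1,\dots,K\}$. For $\boldsymbol{\alpha}\in\mathscr{A}_K$ and fixed $\boldsymbol{\varepsilon}\in\mathscr{E}_{\mathrm{ad}}$, $\boldsymbol{y}^{\boldsymbol{\alpha}}=\boldsymbol{y}^{\boldsymbol{\alpha},\boldsymbol{\varepsilon}}\in\mathscr{Y}$ denotes the unique weak solution of $-\Delta\boldsymbol{y}+\boldsymbol{g}_{\boldsymbol{\alpha}}(\boldsymbol{y})=\boldsymbol{\varepsilon}$ in $\Omega$, $\boldsymbol{y}=0$ on $\Gamma$, i.e. $\int_\Omega\langle\nabla\boldsymbol{y},\nabla\boldsymbol{v}\rangle_{\mathsf F}\,dx+\int_\Omega\boldsymbol{v}\cdot\boldsymbol{g}_{\boldsymbol{\alpha}}(\boldsymbol{y})\,dx=\int_\Omega\boldsymbol{v}\cdot\boldsymbol{\varepsilon}\,dx$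 for all $\boldsymbol{v}\in\mathbb{H}^1_0(\Omega)$, with $\langle\cdot,\cdot\rangle_{\mathsf F}$ the Frobenius inner product. *)

theory Defs
  imports "HOL-Analysis.Analysis"
begin

section \<open>Classical derivatives and domains\<close>

definition partial :: "'n \<Rightarrow> (real^'n \<Rightarrow> 'b::real_normed_vector) \<Rightarrow> real^'n::finite \<Rightarrow> 'b" where
  "partial i f x = frechet_derivative f (at x) (axis i 1)"

primrec Ck :: "nat \<Rightarrow> (real^'n::finite \<Rightarrow> 'b::real_normed_vector) \<Rightarrow> bool" where
  "Ck 0 f \<longleftrightarrow> continuous_on UNIV f"
| "Ck (Suc m) f \<longleftrightarrow> (\<forall>x. f differentiable (at x)) \<and> (\<forall>i. Ck m (partial i f))"

text \<open>Positive semi-definiteness is not meant to include symmetry.\<close>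

definition pos_semidef :: "real^2^2 \<Rightarrow> bool" where
  "pos_semidef A \<longleftrightarrow> (\<forall>z. z \<bullet> (A *v z) \<ge> 0)"

text \<open>
  Near each boundary point and in suitably rotated coordinates, the set lies strictly
  above the graph of a Lipschitz function; the boundary is then locally that graph.
\<close>

definition lipschitz_boundary :: "(real^2) set \<Rightarrow> bool" where
  "lipschitz_boundary \<Omega> \<longleftrightarrow>
     (\<forall>p \<in> frontier \<Omega>. \<exists>U T \<gamma> L. open U \<and> p \<in> U \<and>
        orthogonal_transformation (T :: real^2 \<Rightarrow> real^2) \<and>
        L-lipschitz_on UNIV (\<gamma> :: real \<Rightarrow> real) \<and>
        \<Omega> \<inter> U = {x \<in> U. \<gamma> (T x $ 1) < T x $ 2})"


section \<open>Scalar Lebesgue and Sobolev spaces\<close>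

text \<open>
  Elements of the spaces are functions on the whole of \<open>\<real>\<^sup>n\<close>, of which only the values almost
  everywhere on \<open>\<Omega>\<close> matter; no quotient by almost everywhere equality is taken.
\<close>

definition L2 :: "(real^'n::finite) set \<Rightarrow> (real^'n \<Rightarrow> real) set" where
  "L2 \<Omega> = {u. u \<in> borel_measurable (lebesgue_on \<Omega>) \<and> integrable (lebesgue_on \<Omega>) (\<lambda>x. (u x)\<^sup>2)}"

definition L2_norm :: "(real^'n::finite) set \<Rightarrow> (real^'n \<Rightarrow> 'b::euclidean_space) \<Rightarrow> real" where
  "L2_norm \<Omega> u = sqrt (LINT x|lebesgue_on \<Omega>. (norm (u x))\<^sup>2)"

definition test_functions :: "(real^'n::finite) set \<Rightarrow> (real^'n \<Rightarrow> real) set" where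
  "test_functions \<Omega> = {\<psi>. (\<forall>m. Ck m \<psi>) \<and>
     compact (closure {x. \<psi> x \<noteq> 0}) \<and> closure {x. \<psi> x \<noteq> 0} \<subseteq> \<Omega>}"

definition has_weak_partial ::
  "(real^'n::finite) set \<Rightarrow> 'n \<Rightarrow> (real^'n \<Rightarrow> real) \<Rightarrow> (real^'n \<Rightarrow> real) \<Rightarrow> bool" where
  "has_weak_partial \<Omega> i u w \<longleftrightarrow>
     (\<forall>\<psi> \<in> test_functions \<Omega>.
        (LINT x|lebesgue_on \<Omega>. u x * partial i \<psi> x) = - (LINT x|lebesgue_on \<Omega>. w x * \<psi> x))"

text \<open>\<open>Hm m \<Omega>\<close> is the Sobolev space \<open>H\<^sup>m(\<Omega>) = W\<^sup>m\<^sup>,\<^sup>2(\<Omega>)\<close>.\<close>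

primrec Hm :: "nat \<Rightarrow> (real^'n::finite) set \<Rightarrow> (real^'n \<Rightarrow> real) set" where
  "Hm 0 \<Omega> = L2 \<Omega>"
| "Hm (Suc m) \<Omega> = {u \<in> L2 \<Omega>. \<forall>i. \<exists>w \<in> Hm m \<Omega>. has_weak_partial \<Omega> i u w}"

text \<open>
  A chosen representative of the weak derivative, which is unique up to null sets;
  unspecified when no square-integrable weak derivative exists.
\<close>

definition weak_partial ::
  "(real^'n::finite) set \<Rightarrow> 'n \<Rightarrow> (real^'n \<Rightarrow> real) \<Rightarrow> real^'n \<Rightarrow> real" where
  "weak_partial \<Omega> i u = (SOME w. w \<in> L2 \<Omega> \<and> has_weak_partial \<Omega> i u w)"

definition H1_norm :: "(real^'n::finite) set \<Rightarrow> (real^'n \<Rightarrow> real) \<Rightarrow> real" where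
  "H1_norm \<Omega> u = sqrt ((L2_norm \<Omega> u)\<^sup>2 + (\<Sum>i\<in>UNIV. (L2_norm \<Omega> (weak_partial \<Omega> i u))\<^sup>2))"

text \<open>The closure of the test functions in the \<open>H\<^sup>1\<close> norm.\<close>

definition H10 :: "(real^'n::finite) set \<Rightarrow> (real^'n \<Rightarrow> real) set" where
  "H10 \<Omega> = {u \<in> Hm 1 \<Omega>. \<exists>\<psi>. (\<forall>n. \<psi> n \<in> test_functions \<Omega>) \<and>
     (\<lambda>n. H1_norm \<Omega> (\<lambda>x. u x - \<psi> n x)) \<longlonglongrightarrow> 0}"


section \<open>Vector-valued spaces\<close>

text \<open>The product \<open>X \<times> X\<close>, with pairs of functions read as one function into \<open>\<real>\<^sup>2\<close>.\<close>

definition product_space :: "(real^2 \<Rightarrow> real) set \<Rightarrow> (real^2 \<Rightarrow> real^2) set" where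
  "product_space X = {v. \<forall>i. (\<lambda>x. v x $ i) \<in> X}"

definition weak_gradient :: "(real^2) set \<Rightarrow> (real^2 \<Rightarrow> real^2) \<Rightarrow> real^2 \<Rightarrow> real^2^2" where
  "weak_gradient \<Omega> v x = (\<chi> i j. weak_partial \<Omega> j (\<lambda>x. v x $ i) x)"

definition weak_laplacian :: "(real^2) set \<Rightarrow> (real^2 \<Rightarrow> real^2) \<Rightarrow> real^2 \<Rightarrow> real^2" where
  "weak_laplacian \<Omega> v x =
     (\<chi> i. \<Sum>j\<in>UNIV. weak_partial \<Omega> j (weak_partial \<Omega> j (\<lambda>x. v x $ i)) x)"

definition Y_space :: "(real^2) set \<Rightarrow> (real^2 \<Rightarrow> real^2) set" where
  "Y_space \<Omega> = product_space (Hm 2 \<Omega>) \<inter> product_space (H10 \<Omega>)"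

definition Y_norm :: "(real^2) set \<Rightarrow> (real^2 \<Rightarrow> real^2) \<Rightarrow> real" where
  "Y_norm \<Omega> v = L2_norm \<Omega> (weak_laplacian \<Omega> v)"


section \<open>Controls, coefficients and the state equation\<close>

definition admissible_controls :: "(real^2) set \<Rightarrow> real^2 \<Rightarrow> real^2 \<Rightarrow> (real^2 \<Rightarrow> real^2) set" where
  "admissible_controls \<Omega> \<epsilon>a \<epsilon>b =
     {\<epsilon> \<in> product_space (L2 \<Omega>). AE x in lebesgue_on \<Omega>. \<epsilon>a \<le> \<epsilon> x \<and> \<epsilon> x \<le> \<epsilon>b}"

text \<open>
  A vector in \<open>\<real>\<^sup>K\<close> is a function on \<open>{1..K}\<close>.  The case \<open>k = K\<close> is the full coefficient set.
\<close>

definition coeff_set :: "nat \<Rightarrow> real \<Rightarrow> nat \<Rightarrow> (nat \<Rightarrow> real) set" where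
  "coeff_set K \<alpha>max k = {\<alpha> \<in> {1..K} \<rightarrow>\<^sub>E {0..\<alpha>max}. \<forall>j\<in>{k+1..K}. \<alpha> j = 0}"

definition max_norm :: "nat \<Rightarrow> (nat \<Rightarrow> real) \<Rightarrow> real" where
  "max_norm K \<alpha> = Max ((\<lambda>j. \<bar>\<alpha> j\<bar>) ` {1..K})"

definition lin_indep_family :: "nat \<Rightarrow> (nat \<Rightarrow> real^2 \<Rightarrow> real^2) \<Rightarrow> bool" where
  "lin_indep_family K \<phi> \<longleftrightarrow>
     (\<forall>c. (\<forall>y. (\<Sum>j=1..K. c j *\<^sub>R \<phi> j y) = 0) \<longrightarrow> (\<forall>j\<in>{1..K}. c j = 0))"

definition nonlinearity ::
  "nat \<Rightarrow> (nat \<Rightarrow> real^2 \<Rightarrow> real^2) \<Rightarrow> (nat \<Rightarrow> real) \<Rightarrow> real^2 \<Rightarrow> real^2" where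
  "nonlinearity K \<phi> \<alpha> y = (\<Sum>j=1..K. \<alpha> j *\<^sub>R \<phi> j y)"

text \<open>
  Weak solutions of \<open>-\<Delta> y + g(y) = \<epsilon>\<close> with zero boundary values.  The library inner product
  on matrices is the Frobenius inner product.
\<close>

definition weak_solution ::
  "(real^2) set \<Rightarrow> (real^2 \<Rightarrow> real^2) \<Rightarrow> (real^2 \<Rightarrow> real^2) \<Rightarrow> (real^2 \<Rightarrow> real^2) \<Rightarrow> bool" where
  "weak_solution \<Omega> g \<epsilon> y \<longleftrightarrow> y \<in> Y_space \<Omega> \<and>
     (\<forall>v \<in> product_space (H10 \<Omega>).
        (LINT x|lebesgue_on \<Omega>. weak_gradient \<Omega> y x \<bullet> weak_gradient \<Omega> v x)
          + (LINT x|lebesgue_on \<Omega>. v x \<bullet> g (y x))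
        = (LINT x|lebesgue_on \<Omega>. v x \<bullet> \<epsilon> x))"

end

theory Submission
  imports Defs
begin

text \<open>
  Let \<open>y = y1 - y2\<close> be the difference of two solutions, with nonlinearities \<open>g1\<close> and \<open>g2\<close>.  Solutions
  are in \<open>H\<^sup>2\<close> by definition, so the weak equations can be integrated by parts and hold almost
  everywhere: \<open>\<Delta> y = g1(y1) - g2(y2) = (g1(y1) - g1(y2)) + (g1(y2) - g2(y2))\<close>
  (\<open>laplacian_of_difference\<close>).  The basis functions are bounded and globally Lipschitz, the latter
  because their local Lipschitz constants do not depend on the point
  (\<open>pointwise_lipschitz_imp_lipschitz\<close>).  As only \<open>k\<close> of them occur, the second bracket is bounded by
  \<open>M k \<parallel>\<alpha>1 - \<alpha>2\<parallel>\<close>, and the first by \<open>L \<alpha>max k |y|\<close>.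

  A bound for \<open>y\<close> in \<open>L\<^sup>2\<close> comes from testing the difference of the equations with \<open>y\<close>.  Since \<open>g1\<close> is
  monotone, being a combination of monotone maps with nonnegative coefficients, this gives
  \<open>\<integral> |\<nabla> y|\<^sup>2 \<le> \<integral> |y| |g1(y2) - g2(y2)|\<close>, and the Poincare inequality turns it into an \<open>L\<^sup>2\<close> bound of \<open>y\<close>
  by a multiple of \<open>k \<parallel>\<alpha>1 - \<alpha>2\<parallel>\<close>.  Inserted into the bound for \<open>\<Delta> y\<close>, this yields the order \<open>k\<^sup>2\<close>
  (\<open>weak_solution_stability\<close> and the final theorem).

  The analytic groundwork rests on two facts about test functions.  Integrals of their partial
  derivatives vanish (\<open>integral_partial_eq_0\<close>), which makes classical derivatives weak derivatives and
  yields the Poincare inequality when applied to \<open>x\<^sub>i \<psi>\<^sup>2\<close>.  And there are enough of them: a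
  square-integrable function orthogonal to all test functions is zero almost everywhere
  (\<open>fundamental_lemma_of_calculus_of_variations\<close>), which makes weak derivatives unique and hence linear,
  and lets a weak equation be read as a pointwise one.
\<close>

section \<open>Smooth functions\<close>

lemma partial_eq_derivative:
  assumes "(f has_derivative f') (at x)"
  shows "partial i f x = f' (axis i 1)"
  unfolding partial_def using frechet_derivative_at[OF assms] by simp

lemma has_derivative_frechet: "f differentiable at x \<Longrightarrow> (f has_derivative frechet_derivative f (at x)) (at x)"
  by (simp add: frechet_derivative_works)

lemma partial_const: "partial i (\<lambda>x. c) = (\<lambda>x. 0)"
  by (rule ext, subst partial_eq_derivative[of _ "\<lambda>h. 0"]) auto

lemma partial_add:
  assumes "f differentiable at x" "g differentiable at x"
  shows "partial i (\<lambda>x. f x + g x) x = partial i f x + partial i g x"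
  by (subst partial_eq_derivative[OF has_derivative_add[OF assms[THEN has_derivative_frechet]]])
     (simp add: partial_def)

lemma partial_mult:
  fixes f g :: "real^'n::finite \<Rightarrow> real"
  assumes "f differentiable at x" "g differentiable at x"
  shows "partial i (\<lambda>x. f x * g x) x = f x * partial i g x + partial i f x * g x"
  by (subst partial_eq_derivative[OF has_derivative_mult[OF assms[THEN has_derivative_frechet]]])
     (simp add: partial_def)

lemma Ck_SucD: "Ck (Suc m) f \<Longrightarrow> Ck m f"
proof (induction m arbitrary: f)
  case 0
  then show ?case
    by (auto intro!: continuous_at_imp_continuous_on differentiable_imp_continuous_within)
qed simp

lemma Ck_continuous: "Ck m f \<Longrightarrow> continuous_on UNIV f"
  by (induction m) (auto dest: Ck_SucD simp del: Ck.simps(2))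

lemma Ck_const: "Ck m (\<lambda>x. c)"
  by (induction m arbitrary: c) (auto simp: partial_const)

lemma Ck_add: "Ck m f \<Longrightarrow> Ck m g \<Longrightarrow> Ck m (\<lambda>x. f x + g x)"
proof (induction m arbitrary: f g)
  case 0
  then show ?case by (auto intro: continuous_intros)
next
  case (Suc m)
  then have "partial i (\<lambda>x. f x + g x) = (\<lambda>x. partial i f x + partial i g x)" for i
    by (auto intro!: ext partial_add)
  with Suc show ?case by auto
qed

lemma Ck_mult:
  fixes f g :: "real^'n::finite \<Rightarrow> real"
  shows "Ck m f \<Longrightarrow> Ck m g \<Longrightarrow> Ck m (\<lambda>x. f x * g x)"
proof (induction m arbitrary: f g)
  case 0
  then show ?case by (auto intro: continuous_intros)
next
  case (Suc m)
  have "partial i (\<lambda>x. f x * g x) = (\<lambda>x. f x * partial i g x + partial i f x * g x)" for i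
    using Suc.prems by (auto intro!: ext partial_mult)
  moreover have "Ck m (\<lambda>x. f x * partial i g x + partial i f x * g x)" for i
    using Suc.prems Ck_SucD[OF Suc.prems(1)] Ck_SucD[OF Suc.prems(2)]
    by (intro Ck_add Suc.IH[of f] Suc.IH[of _ g]) auto
  ultimately show ?case using Suc.prems by (auto intro: differentiable_mult)
qed

lemma Ck_diff:
  fixes f g :: "real^'n::finite \<Rightarrow> real"
  assumes "Ck m f" "Ck m g"
  shows "Ck m (\<lambda>x. f x - g x)"
  using Ck_add[OF assms(1) Ck_mult[OF Ck_const[of m "-1"] assms(2)]] by simp

lemma Ck_prod:
  fixes f :: "'i \<Rightarrow> real^'n::finite \<Rightarrow> real"
  shows "(\<And>i. i \<in> I \<Longrightarrow> Ck m (f i)) \<Longrightarrow> Ck m (\<lambda>x. \<Prod>i\<in>I. f i x)"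
proof (induction I rule: infinite_finite_induct)
  case (insert i I)
  then have "Ck m (f i)" "Ck m (\<lambda>x. \<Prod>i\<in>I. f i x)" by auto
  from Ck_mult[OF this] insert.hyps show ?case by simp
qed (simp_all add: Ck_const)

lemma Ck_component: "Ck m (\<lambda>x::real^'n::finite. x $ i)"
proof (cases m)
  case (Suc k)
  have d: "((\<lambda>x::real^'n. x $ i) has_derivative (\<lambda>h. h $ i)) (at x)" for x
    by (rule bounded_linear_imp_has_derivative) (rule bounded_linear_vec_nth)
  have "partial j (\<lambda>x::real^'n. x $ i) = (\<lambda>x. axis j 1 $ i)" for j
    by (rule ext, rule partial_eq_derivative[OF d])
  then show ?thesis using Suc d by (auto simp: Ck_const differentiable_def)
qed (auto intro: continuous_intros)

section \<open>Smooth bumps on boxes\<close>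

text \<open>
  The functions \<open>p(1/t) exp(-1/t)\<close>, extended by zero to \<open>t \<le> 0\<close>, are closed under
  differentiation, which gives all derivatives of \<open>exp(-1/t)\<close> at once.
\<close>

definition flat :: "real poly \<Rightarrow> real \<Rightarrow> real" where
  "flat p t = (if t > 0 then poly p (1/t) * exp (- (1/t)) else 0)"

lemma poly_times_exp_minus_tendsto_0: "((\<lambda>s::real. poly p s * exp (- s)) \<longlongrightarrow> 0) at_top"
proof -
  have "((\<lambda>s. coeff p i * (s ^ i / exp s)) \<longlongrightarrow> 0) at_top" for i
    using tendsto_mult_right_zero[OF tendsto_power_div_exp_0] by auto
  then have "((\<lambda>s. \<Sum>i\<le>degree p. coeff p i * (s ^ i / exp s)) \<longlongrightarrow> 0) at_top"
    by (rule tendsto_null_sum)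
  then show ?thesis
    by (simp add: poly_altdef exp_minus sum_distrib_right divide_inverse mult.assoc)
qed

lemma flat_has_derivative:
  "(flat p has_real_derivative flat ([:0, 0, 1:] * (p - pderiv p)) t) (at t)"
proof -
  consider "t > 0" | "t < 0" | "t = 0" by linarith
  then show ?thesis
  proof cases
    case 1
    have "((\<lambda>t. poly p (1/t) * exp (- (1/t))) has_real_derivative
       flat ([:0, 0, 1:] * (p - pderiv p)) t) (at t)"
      using 1 unfolding flat_def
      by (auto intro!: derivative_eq_intros DERIV_chain2[OF poly_DERIV]
          simp: field_simps power2_eq_square)
    then show ?thesis
      by (rule has_field_derivative_transform_within_open[of _ _ _ "{0<..}"])
         (use 1 in \<open>auto simp: flat_def\<close>)
  next
    case 2
    have "((\<lambda>t. 0) has_real_derivative flat ([:0, 0, 1:] * (p - pderiv p)) t) (at t)"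
      using 2 by (auto simp: flat_def)
    then show ?thesis
      by (rule has_field_derivative_transform_within_open[of _ _ _ "{..<0}"])
         (use 2 in \<open>auto simp: flat_def\<close>)
  next
    case 3
    \<comment> \<open>To the right of zero the difference quotient is \<open>s p(s) exp(-s)\<close> at \<open>s = 1/y\<close>.\<close>
    have "((\<lambda>y. flat p y / y) \<longlongrightarrow> 0) (at_left 0)"
      by (rule tendsto_eventually) (auto simp: eventually_at_filter flat_def)
    moreover have "((\<lambda>y. flat p y / y) \<longlongrightarrow> 0) (at_right 0)"
    proof -
      have "((\<lambda>s. poly ([:0,1:] * p) s * exp (- s)) \<longlongrightarrow> 0) at_top"
        by (rule poly_times_exp_minus_tendsto_0)
      from filterlim_compose[OF this filterlim_inverse_at_top_right]
      show ?thesis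
        by (rule Lim_transform_eventually)
           (auto simp: flat_def eventually_at_filter field_simps)
    qed
    ultimately have "((\<lambda>y. flat p y / y) \<longlongrightarrow> 0) (at 0)"
      by (simp add: filterlim_split_at)
    then show ?thesis
      using 3 by (simp add: has_field_derivative_iff flat_def)
  qed
qed

lemma Ck_flat_affine:
  "Ck m (\<lambda>x::real^'n::finite. flat p (c * (x $ i) + d))"
proof (induction m arbitrary: p)
  case 0
  have "continuous_on UNIV (flat p)"
    by (meson DERIV_isCont continuous_at_imp_continuous_on flat_has_derivative)
  then show ?case
    by (auto intro!: continuous_intros continuous_on_compose2[of UNIV "flat p"])
next
  case (Suc m)
  define q where "q = [:0, 0, 1:] * (p - pderiv p)"
  have der: "((\<lambda>x::real^'n. flat p (c * (x $ i) + d)) has_derivative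
      (\<lambda>h. flat q (c * (x $ i) + d) * (c * h $ i))) (at x)" for x
  proof -
    have "((\<lambda>x::real^'n. c * (x $ i) + d) has_derivative (\<lambda>h. c * h $ i)) (at x)"
      using has_derivative_add_const[OF has_derivative_mult_right[OF
          bounded_linear_imp_has_derivative[OF bounded_linear_vec_nth]]] .
    from has_derivative_compose[OF this flat_has_derivative[unfolded has_field_derivative_def]]
    show ?thesis unfolding q_def .
  qed
  have "partial j (\<lambda>x::real^'n. flat p (c * (x $ i) + d)) =
      (\<lambda>x. flat q (c * (x $ i) + d) * (c * axis j 1 $ i))" for j
    by (rule ext, rule partial_eq_derivative[OF der])
  then show ?case
    using der Ck_mult[OF Suc.IH[of q] Ck_const] by (auto simp: differentiable_def)
qed

text \<open>
  The factor \<open>flat 1 (n t) = exp(-1/(n t))\<close> increases to one for every \<open>t > 0\<close> as \<open>n\<close> grows, so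
  these bumps approximate the indicator of the box without any cutoff or convolution.
\<close>

definition box_bump :: "real^'n::finite \<Rightarrow> real^'n \<Rightarrow> nat \<Rightarrow> real^'n \<Rightarrow> real" where
  "box_bump a b n x =
     (\<Prod>i\<in>UNIV. flat 1 (real (Suc n) * (x $ i - a $ i)) * flat 1 (real (Suc n) * (b $ i - x $ i)))"

lemma flat_1_bounds: "0 \<le> flat 1 t" "flat 1 t \<le> 1"
  by (auto simp: flat_def)

lemma box_bump_bounds: "0 \<le> box_bump a b n x" "box_bump a b n x \<le> 1"
  unfolding box_bump_def
  by (auto intro!: prod_nonneg prod_le_1 mult_le_one simp: flat_1_bounds)

lemma Ck_box_bump: "Ck m (box_bump a b n)"
proof -
  have "Ck m (\<lambda>x. flat 1 (real (Suc n) * (x $ i - a $ i)) * flat 1 (real (Suc n) * (b $ i - x $ i)))"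
    for i
    using Ck_mult[OF Ck_flat_affine[of m 1 "real (Suc n)" i "- (real (Suc n) * a $ i)"]
        Ck_flat_affine[of m 1 "- real (Suc n)" i "real (Suc n) * b $ i"]]
    by (simp add: algebra_simps)
  then show ?thesis unfolding box_bump_def by (rule Ck_prod)
qed

lemma box_bump_eq_0: "x \<notin> box a b \<Longrightarrow> box_bump a b n x = 0"
proof -
  assume "x \<notin> box a b"
  then obtain i where "x $ i \<le> a $ i \<or> b $ i \<le> x $ i"
    by (auto simp: mem_box_cart not_less)
  then have "flat 1 (real (Suc n) * (x $ i - a $ i)) * flat 1 (real (Suc n) * (b $ i - x $ i)) = 0"
    by (auto simp: flat_def zero_less_mult_iff)
  then show ?thesis unfolding box_bump_def by (auto intro!: prod_zero)
qed

lemma box_bump_tendsto: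
  fixes x :: "real^'n::finite"
  shows "(\<lambda>n. box_bump a b n x) \<longlonglongrightarrow> indicator (box a b) x"
proof (cases "x \<in> box a b")
  case True
  have lim: "(\<lambda>n. flat 1 (real (Suc n) * t)) \<longlonglongrightarrow> 1" if "t > 0" for t
  proof -
    have "(\<lambda>n. exp (- (inverse (real (Suc n)) * (1 / t)))) \<longlonglongrightarrow> exp (- (0 * (1 / t)))"
      by (intro tendsto_intros LIMSEQ_inverse_real_of_nat)
    moreover have "flat 1 (real (Suc n) * t) = exp (- (inverse (real (Suc n)) * (1 / t)))" for n
      using that by (simp add: flat_def field_simps add_pos_nonneg)
    ultimately show ?thesis by simp
  qed
  have "(\<lambda>n. box_bump a b n x) \<longlonglongrightarrow> (\<Prod>i\<in>(UNIV::'n set). 1 * 1)"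
    unfolding box_bump_def using True
    by (intro tendsto_prod tendsto_mult lim) (auto simp: mem_box_cart)
  then show ?thesis using True by simp
qed (simp add: box_bump_eq_0)

lemma box_bump_test_function:
  assumes "cbox a b \<subseteq> \<Omega>"
  shows "box_bump a b n \<in> test_functions \<Omega>"
proof -
  have supp: "{x. box_bump a b n x \<noteq> 0} \<subseteq> cbox a b"
    using box_bump_eq_0 box_subset_cbox by blast
  then have "closure {x. box_bump a b n x \<noteq> 0} \<subseteq> cbox a b"
    by (rule closure_minimal) (rule closed_cbox)
  with assms show ?thesis
    unfolding test_functions_def
    using bounded_subset[OF bounded_cbox supp] by (auto simp: Ck_box_bump)
qed

section \<open>Test functions\<close>

lemma partial_eq_0_off_support:
  assumes "x \<notin> closure {x. f x \<noteq> 0}"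
  shows "partial i f x = 0"
proof -
  have "((\<lambda>x. 0) has_derivative (\<lambda>h. 0)) (at x)" by simp
  then have "(f has_derivative (\<lambda>h. 0)) (at x)"
    by (rule has_derivative_transform_within_open[of _ _ _ _ "- closure {x. f x \<noteq> 0}"])
       (use assms closure_subset[of "{x. f x \<noteq> 0}"] in auto)
  then show ?thesis by (rule partial_eq_derivative)
qed

lemma test_functionsI:
  assumes "\<And>m. Ck m f" "{x. f x \<noteq> 0} \<subseteq> S" "compact S" "S \<subseteq> \<Omega>"
  shows "f \<in> test_functions \<Omega>"
proof -
  have "closure {x. f x \<noteq> 0} \<subseteq> S"
    using assms(2,3) by (simp add: closure_minimal compact_imp_closed)
  moreover have "bounded {x. f x \<noteq> 0}"
    using assms(2,3) bounded_subset compact_imp_bounded by blast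
  ultimately show ?thesis using assms by (auto simp: test_functions_def)
qed

lemma test_functions_Ck: "f \<in> test_functions \<Omega> \<Longrightarrow> Ck m f"
  and test_functions_compact: "f \<in> test_functions \<Omega> \<Longrightarrow> compact (closure {x. f x \<noteq> 0})"
  and test_functions_support: "f \<in> test_functions \<Omega> \<Longrightarrow> closure {x. f x \<noteq> 0} \<subseteq> \<Omega>"
  by (auto simp: test_functions_def)

lemma test_functions_differentiable: "f \<in> test_functions \<Omega> \<Longrightarrow> f differentiable at x"
  using test_functions_Ck[of f \<Omega> "Suc 0"] by simp

lemma test_functions_0: "(\<lambda>x. 0) \<in> test_functions \<Omega>"
  by (simp add: test_functions_def Ck_const)

lemma test_functions_diff:
  assumes "f \<in> test_functions \<Omega>" "g \<in> test_functions \<Omega>"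
  shows "(\<lambda>x. f x - g x) \<in> test_functions \<Omega>"
proof (rule test_functionsI)
  show "{x. f x - g x \<noteq> 0} \<subseteq> closure {x. f x \<noteq> 0} \<union> closure {x. g x \<noteq> 0}"
  proof -
    have "{x. f x - g x \<noteq> 0} \<subseteq> {x. f x \<noteq> 0} \<union> {x. g x \<noteq> 0}" by auto
    also have "\<dots> \<subseteq> closure {x. f x \<noteq> 0} \<union> closure {x. g x \<noteq> 0}"
      by (intro Un_mono closure_subset)
    finally show ?thesis .
  qed
  show "Ck m (\<lambda>x. f x - g x)" for m
    by (rule Ck_diff[OF assms[THEN test_functions_Ck]])
qed (use assms in \<open>auto simp: test_functions_def\<close>)

lemma test_functions_mult:
  assumes "f \<in> test_functions \<Omega>" "\<And>m. Ck m g"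
  shows "(\<lambda>x. f x * g x) \<in> test_functions \<Omega>"
proof (rule test_functionsI)
  show "{x. f x * g x \<noteq> 0} \<subseteq> closure {x. f x \<noteq> 0}"
    using closure_subset[of "{x. f x \<noteq> 0}"] by auto
  show "Ck m (\<lambda>x. f x * g x)" for m
    by (rule Ck_mult[OF assms(1)[THEN test_functions_Ck] assms(2)])
qed (use assms in \<open>auto simp: test_functions_def\<close>)

lemma test_functions_partial:
  assumes "f \<in> test_functions \<Omega>"
  shows "partial i f \<in> test_functions \<Omega>"
proof (rule test_functionsI)
  show "{x. partial i f x \<noteq> 0} \<subseteq> closure {x. f x \<noteq> 0}"
    using partial_eq_0_off_support by blast
  show "Ck m (partial i f)" for m
    using test_functions_Ck[OF assms, of "Suc m"] by simp
qed (use assms in \<open>auto simp: test_functions_def\<close>)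

lemma test_functions_bounded:
  fixes f :: "real^'n::finite \<Rightarrow> real"
  assumes "f \<in> test_functions \<Omega>"
  obtains B where "B > 0" "\<And>x. \<bar>f x\<bar> \<le> B"
proof -
  have "continuous_on (closure {x. f x \<noteq> 0}) f"
    using Ck_continuous[OF test_functions_Ck[OF assms, of 0]] continuous_on_subset by blast
  from compact_imp_bounded[OF compact_continuous_image[OF this test_functions_compact[OF assms]]]
  obtain B where B: "B > 0" "\<And>x. x \<in> closure {x. f x \<noteq> 0} \<Longrightarrow> \<bar>f x\<bar> \<le> B"
    unfolding bounded_pos by auto
  have "\<bar>f x\<bar> \<le> B" for x
    using B closure_subset[of "{x. f x \<noteq> 0}"] by (cases "f x = 0") auto
  with B(1) that show thesis by blast
qed

lemma test_functions_mono: "f \<in> test_functions \<Omega> \<Longrightarrow> \<Omega> \<subseteq> \<Omega>' \<Longrightarrow> f \<in> test_functions \<Omega>'"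
  by (auto simp: test_functions_def)

lemma test_functions_borel: "f \<in> test_functions \<Omega> \<Longrightarrow> f \<in> borel_measurable borel"
  using Ck_continuous[OF test_functions_Ck[of _ _ 0]] by (rule borel_measurable_continuous_onI)

lemma test_functions_eq_0: "f \<in> test_functions \<Omega> \<Longrightarrow> x \<notin> \<Omega> \<Longrightarrow> f x = 0"
  using test_functions_support[of f \<Omega>] closure_subset[THEN subsetD, of x "{x. f x \<noteq> 0}"] by auto

lemma cball_indicator_integrable:
  "integrable lborel (\<lambda>x::'a::euclidean_space. c * indicator (cball a r) x :: real)"
  using emeasure_bounded_finite[OF bounded_cball[of a r]]
  by (intro integrable_mult_right integrable_real_indicator) auto

lemma test_function_translate_integrable:
  fixes f :: "real^'n::finite \<Rightarrow> real"
  assumes f: "f \<in> test_functions \<Omega>"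
  shows "integrable lborel (\<lambda>x. f (x + c))"
proof -
  have [measurable]: "f \<in> borel_measurable borel" by (rule test_functions_borel[OF f])
  obtain R where R: "\<And>x. f x \<noteq> 0 \<Longrightarrow> norm x \<le> R"
    using compact_imp_bounded[OF test_functions_compact[OF f]] closure_subset[of "{x. f x \<noteq> 0}"]
    unfolding bounded_iff by blast
  obtain B where "B > 0" "\<And>x. \<bar>f x\<bar> \<le> B" using test_functions_bounded[OF f] by blast
  moreover have "x \<in> cball 0 (R + norm c)" if "f (x + c) \<noteq> 0" for x
    using R[OF that] norm_triangle_ineq4[of "x + c" c] by simp
  ultimately have bound: "norm (f (x + c)) \<le> norm (B * indicator (cball 0 (R + norm c)) x)" for x
    by (cases "f (x + c) = 0") auto
  have "integrable lborel (\<lambda>x. B * indicator (cball 0 (R + norm c)) x :: real)"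
    by (rule cball_indicator_integrable)
  then show ?thesis
    by (rule Bochner_Integration.integrable_bound) (use bound in auto)
qed

text \<open>
  Difference quotients have integral zero because Lebesgue measure is translation invariant, and
  they converge boundedly to the derivative.
\<close>

lemma integral_partial_test_function:
  fixes f :: "real^'n::finite \<Rightarrow> real"
  assumes f: "f \<in> test_functions UNIV"
  shows "(LINT x|lborel. partial i f x) = 0"
proof -
  have [measurable]: "f \<in> borel_measurable borel" "partial i f \<in> borel_measurable borel"
    using f test_functions_partial[OF f] by (auto intro: test_functions_borel)
  define e where "e = axis i (1::real)"
  obtain R where R: "\<And>x. f x \<noteq> 0 \<Longrightarrow> norm x \<le> R"
    using compact_imp_bounded[OF test_functions_compact[OF f]] closure_subset[of "{x. f x \<noteq> 0}"]
    unfolding bounded_iff by blast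
  obtain B where B: "B > 0" "\<And>x. \<bar>partial i f x\<bar> \<le> B"
    using test_functions_bounded[OF test_functions_partial[OF f]] by blast
  have line: "((\<lambda>t. f (x + t *\<^sub>R e)) has_real_derivative partial i f (x + t *\<^sub>R e)) (at t)" for x t
  proof -
    have "((\<lambda>t. x + t *\<^sub>R e) has_derivative (\<lambda>h. h *\<^sub>R e)) (at t)"
      by (auto intro!: derivative_eq_intros)
    from has_derivative_compose[OF this
        has_derivative_frechet[OF test_functions_differentiable[OF f]]]
    have "((\<lambda>t. f (x + t *\<^sub>R e)) has_derivative
        (\<lambda>h. frechet_derivative f (at (x + t *\<^sub>R e)) (h *\<^sub>R e))) (at t)" .
    moreover have "frechet_derivative f (at z) (h *\<^sub>R e) = partial i f z * h" for h z
      using linear_cmul[OF linear_frechet_derivative[OF test_functions_differentiable[OF f, of z]]]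
      by (simp add: partial_def e_def)
    ultimately show ?thesis by (simp add: has_field_derivative_def)
  qed
  define q where "q n x = real (Suc n) * (f (x + inverse (real (Suc n)) *\<^sub>R e) - f x)" for n x
  note f_int = test_function_translate_integrable[OF f]
  have shift: "(LINT x|lborel. f (x + c)) = (LINT x|lborel. f x)" for c
    by (subst (2) lborel_distr_plus[of c, symmetric]) (simp add: integral_distr add.commute)
  have "(LINT x|lborel. q n x) = 0" for n
    unfolding q_def using f_int[of 0] f_int shift by simp
  moreover have "(\<lambda>n. LINT x|lborel. q n x) \<longlonglongrightarrow> (LINT x|lborel. partial i f x)"
  proof (rule integral_dominated_convergence[where w = "\<lambda>x. B * indicator (cball 0 (R + 1)) x"])
    show "AE x in lborel. (\<lambda>n. q n x) \<longlonglongrightarrow> partial i f x"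
    proof (rule AE_I2)
      fix x
      have "((\<lambda>h. (f (x + h *\<^sub>R e) - f x) / h) \<longlongrightarrow> partial i f x) (at 0)"
        using line[of x 0] by (simp add: has_field_derivative_iff)
      moreover have "filterlim (\<lambda>n. inverse (real (Suc n))) (at 0) sequentially"
        by (auto simp: filterlim_at simp del: of_nat_Suc intro: LIMSEQ_inverse_real_of_nat)
      ultimately have "(\<lambda>n. (f (x + inverse (real (Suc n)) *\<^sub>R e) - f x) / inverse (real (Suc n)))
          \<longlonglongrightarrow> partial i f x"
        by (rule filterlim_compose)
      then show "(\<lambda>n. q n x) \<longlonglongrightarrow> partial i f x"
        by (simp add: q_def divide_inverse mult.commute)
    qed
    show "AE x in lborel. norm (q n x) \<le> B * indicator (cball 0 (R + 1)) x" for n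
    proof (rule AE_I2)
      fix x
      define h where "h = inverse (real (Suc n))"
      have h: "0 < h" "h \<le> 1" by (auto simp: h_def field_simps)
      show "norm (q n x) \<le> B * indicator (cball 0 (R + 1)) x"
      proof (cases "norm x \<le> R + 1")
        case True
        obtain z where "f (x + h *\<^sub>R e) - f (x + 0 *\<^sub>R e) = (h - 0) * partial i f (x + z *\<^sub>R e)"
          using MVT2[OF h(1) line[of x]] by blast
        then have "q n x = partial i f (x + z *\<^sub>R e)"
          using h(1) by (simp add: q_def h_def[symmetric]) (simp add: h_def)
        then show ?thesis using B True by simp
      next
        case False
        have "norm (h *\<^sub>R e) \<le> 1" using h by (simp add: e_def)
        then have "\<not> norm (x + h *\<^sub>R e) \<le> R"
          using False norm_triangle_ineq4[of "x + h *\<^sub>R e" "h *\<^sub>R e"] by simp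
        then have "f (x + h *\<^sub>R e) = 0" "f x = 0" using R[of "x + h *\<^sub>R e"] R[of x] False by auto
        then have "q n x = 0" by (simp only: q_def h_def) simp
        then show ?thesis using B(1) by simp
      qed
    qed
  qed (use cball_indicator_integrable[of 1 0 "R + 1"] in \<open>auto simp: q_def\<close>)
  ultimately show ?thesis using LIMSEQ_unique[OF _ tendsto_const] by fastforce
qed

lemma lebesgue_on_integral_eq_lborel:
  fixes f :: "real^'n::finite \<Rightarrow> real"
  assumes "\<Omega> \<in> sets lebesgue" "f \<in> borel_measurable borel" "\<And>x. x \<notin> \<Omega> \<Longrightarrow> f x = 0"
  shows "(LINT x|lebesgue_on \<Omega>. f x) = (LINT x|lborel. f x)"
proof -
  have "(\<lambda>x. indicator \<Omega> x *\<^sub>R f x) = f" using assms(3) by (auto simp: indicator_def fun_eq_iff)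
  then show ?thesis
    using assms by (subst integral_restrict_space) (auto simp: integral_completion)
qed

lemma integral_partial_eq_0:
  assumes "open \<Omega>" "f \<in> test_functions \<Omega>"
  shows "(LINT x|lebesgue_on \<Omega>. partial i f x) = 0"
proof -
  have p: "partial i f \<in> test_functions \<Omega>" by (rule test_functions_partial[OF assms(2)])
  show ?thesis
    using assms(1) test_functions_borel[OF p] test_functions_eq_0[OF p]
      integral_partial_test_function[OF test_functions_mono[OF assms(2)]]
    by (subst lebesgue_on_integral_eq_lborel) auto
qed

section \<open>Square-integrable functions\<close>

lemma L2_measurable: "u \<in> L2 \<Omega> \<Longrightarrow> u \<in> borel_measurable (lebesgue_on \<Omega>)"
  and L2_square_integrable: "u \<in> L2 \<Omega> \<Longrightarrow> integrable (lebesgue_on \<Omega>) (\<lambda>x. (u x)\<^sup>2)"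
  by (auto simp: L2_def)

lemma L2_mult_integrable:
  assumes "u \<in> L2 \<Omega>" "v \<in> L2 \<Omega>"
  shows "integrable (lebesgue_on \<Omega>) (\<lambda>x. u x * v x)"
proof (rule Bochner_Integration.integrable_bound)
  note [measurable] = assms[THEN L2_measurable]
  show "integrable (lebesgue_on \<Omega>) (\<lambda>x. (u x)\<^sup>2 + (v x)\<^sup>2)"
    using assms by (intro Bochner_Integration.integrable_add L2_square_integrable)
  show "(\<lambda>x. u x * v x) \<in> borel_measurable (lebesgue_on \<Omega>)" by measurable
  have "\<bar>a * b\<bar> \<le> a\<^sup>2 + b\<^sup>2" for a b :: real
    using sum_squares_bound[of "\<bar>a\<bar>" "\<bar>b\<bar>"] abs_ge_zero[of "a * b"]
    unfolding abs_mult power2_abs by linarith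
  then show "AE x in lebesgue_on \<Omega>. norm (u x * v x) \<le> norm ((u x)\<^sup>2 + (v x)\<^sup>2)"
    by simp
qed

lemma L2_cmult: "u \<in> L2 \<Omega> \<Longrightarrow> (\<lambda>x. c * u x) \<in> L2 \<Omega>"
  by (auto simp: L2_def power_mult_distrib)

lemma L2_add:
  assumes "u \<in> L2 \<Omega>" "v \<in> L2 \<Omega>"
  shows "(\<lambda>x. u x + v x) \<in> L2 \<Omega>"
proof -
  have "integrable (lebesgue_on \<Omega>) (\<lambda>x. (u x)\<^sup>2 + (v x)\<^sup>2 + 2 * (u x * v x))"
    by (intro Bochner_Integration.integrable_add integrable_mult_right L2_square_integrable
        L2_mult_integrable assms)
  also have "(\<lambda>x. (u x)\<^sup>2 + (v x)\<^sup>2 + 2 * (u x * v x)) = (\<lambda>x. (u x + v x)\<^sup>2)"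
    by (simp add: power2_sum mult.assoc)
  finally show ?thesis using assms by (auto simp: L2_def)
qed

lemma L2_diff: "u \<in> L2 \<Omega> \<Longrightarrow> v \<in> L2 \<Omega> \<Longrightarrow> (\<lambda>x. u x - v x) \<in> L2 \<Omega>"
  using L2_add[OF _ L2_cmult[of v \<Omega> "-1"], of u] by simp

lemma L2_0: "(\<lambda>x. 0) \<in> L2 \<Omega>"
  by (simp add: L2_def)

lemma L2_sum: "(\<And>i. i \<in> I \<Longrightarrow> u i \<in> L2 \<Omega>) \<Longrightarrow> (\<lambda>x. \<Sum>i\<in>I. u i x) \<in> L2 \<Omega>"
proof (induction I rule: infinite_finite_induct)
  case (insert i I)
  then have "u i \<in> L2 \<Omega>" "(\<lambda>x. \<Sum>i\<in>I. u i x) \<in> L2 \<Omega>" by auto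
  from L2_add[OF this] insert.hyps show ?case by simp
qed (simp_all add: L2_0)

lemma L2_bounded:
  assumes "\<Omega> \<in> lmeasurable" "u \<in> borel_measurable (lebesgue_on \<Omega>)" "\<And>x. \<bar>u x\<bar> \<le> B"
  shows "u \<in> L2 \<Omega>"
proof -
  interpret finite_measure "lebesgue_on \<Omega>" using assms(1) by (rule finite_measure_lebesgue_on)
  have "\<bar>(u x)\<^sup>2\<bar> \<le> B\<^sup>2" for x
    using power_mono[OF assms(3) abs_ge_zero, of x 2] by simp
  then show ?thesis
    using assms(2) by (auto simp: L2_def intro!: integrable_const_bound[of _ "B\<^sup>2"])
qed

lemma test_functions_integrable:
  fixes \<psi> :: "real^'n::finite \<Rightarrow> real"
  assumes "open \<Omega>" "\<psi> \<in> test_functions \<Omega>"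
  shows "integrable (lebesgue_on \<Omega>) \<psi>"
proof -
  have "(\<lambda>x. indicator \<Omega> x *\<^sub>R \<psi> x) = \<psi>"
    using test_functions_eq_0[OF assms(2)] by (auto simp: indicator_def fun_eq_iff)
  then show ?thesis
    using assms test_function_translate_integrable[OF assms(2), of 0] test_functions_borel[OF assms(2)]
    by (subst integrable_restrict_space) (auto simp: integrable_completion)
qed

lemma test_functions_measurable:
  "\<psi> \<in> test_functions \<Omega> \<Longrightarrow> \<psi> \<in> borel_measurable (lebesgue_on \<Omega>)"
  by (auto dest!: test_functions_borel intro!: measurable_restrict_space1 measurable_completion)

lemma test_functions_L2:
  fixes \<psi> :: "real^'n::finite \<Rightarrow> real"
  assumes "open \<Omega>" "\<psi> \<in> test_functions \<Omega>"
  shows "\<psi> \<in> L2 \<Omega>"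
  using test_functions_integrable[OF assms(1) test_functions_mult[OF assms(2) test_functions_Ck[OF assms(2)]]]
    test_functions_measurable[OF assms(2)]
  by (simp add: L2_def power2_eq_square)

section \<open>The fundamental lemma of the calculus of variations\<close>

lemma box_integral_eq_0:
  fixes w :: "real^'n::finite \<Rightarrow> real"
  assumes "open \<Omega>" and w: "w \<in> L2 \<Omega>"
    and orth: "\<forall>\<psi>\<in>test_functions \<Omega>. (LINT x|lebesgue_on \<Omega>. w x * \<psi> x) = 0"
    and ab: "cbox a b \<subseteq> \<Omega>"
  shows "integrable (lebesgue_on \<Omega>) (\<lambda>x. w x * indicator (box a b) x)"
    and "(LINT x|lebesgue_on \<Omega>. w x * indicator (box a b) x) = 0"
proof -
  note [measurable] = L2_measurable[OF w] test_functions_measurable[OF box_bump_test_function[OF ab]]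
  have [simp]: "\<Omega> \<inter> space lebesgue \<in> sets lebesgue" using assms(1) by simp
  have box [measurable]: "indicator (box a b) \<in> borel_measurable (lebesgue_on \<Omega>)"
    by (intro measurable_restrict_space1 borel_measurable_indicator) auto
  have "(indicator (box a b) :: _ \<Rightarrow> real) \<in> L2 \<Omega>"
  proof -
    have "box a b \<inter> \<Omega> \<in> lmeasurable"
      using assms(1) by (intro fmeasurable_Int_fmeasurable) auto
    then have "integrable lebesgue (indicator (\<Omega> \<inter> box a b) :: _ \<Rightarrow> real)"
      by (intro integrable_real_indicator) (auto simp: fmeasurable_def Int_commute)
    moreover have "(\<lambda>x. (indicator \<Omega> x :: real) *\<^sub>R (indicator (box a b) x)\<^sup>2)
        = (indicator (\<Omega> \<inter> box a b) :: _ \<Rightarrow> real)"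
      by (simp add: indicator_def fun_eq_iff)
    ultimately show ?thesis
      using box assms(1) by (simp add: L2_def integrable_restrict_space)
  qed
  from L2_mult_integrable[OF w this]
  show int: "integrable (lebesgue_on \<Omega>) (\<lambda>x. w x * indicator (box a b) x)" .
  have "(\<lambda>n. LINT x|lebesgue_on \<Omega>. w x * box_bump a b n x)
      \<longlonglongrightarrow> (LINT x|lebesgue_on \<Omega>. w x * indicator (box a b) x)"
  proof (rule integral_dominated_convergence[OF _ _ integrable_norm[OF int]])
    show "AE x in lebesgue_on \<Omega>.
        norm (w x * box_bump a b n x) \<le> norm (w x * indicator (box a b) x)" for n
    proof (rule AE_I2)
      show "norm (w x * box_bump a b n x) \<le> norm (w x * indicator (box a b) x)" for x
        using box_bump_bounds[of a b n x] box_bump_eq_0[of x a b n]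
        by (cases "x \<in> box a b") (auto simp: abs_mult intro: mult_left_le)
    qed
  qed (auto intro!: tendsto_mult box_bump_tendsto)
  then show "(LINT x|lebesgue_on \<Omega>. w x * indicator (box a b) x) = 0"
    using orth box_bump_test_function[OF ab] by (simp add: LIMSEQ_const_iff)
qed

text \<open>
  The Borel sets on which the integral vanishes form a Dynkin system, and boxes are a generator
  that is stable under intersections.
\<close>

lemma AE_eq_0_if_box_integrals_0:
  fixes f :: "'a::euclidean_space \<Rightarrow> real"
  assumes f: "integrable lborel f" and all: "(LINT x|lborel. f x) = 0"
    and box: "\<And>a b. (LINT x:box a b|lborel. f x) = 0"
  shows "AE x in lborel. f x = 0"
proof (rule sigma_finite_measure.density_zero[OF sigma_finite_lborel f])
  fix A :: "'a set" assume "A \<in> sets lborel"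
  have int: "set_integrable lborel A f" if "A \<in> sets borel" for A
    using integrable_mult_indicator[OF _ f, of A] that by (simp add: set_integrable_def)
  have "Int_stable (range (\<lambda>(a, b). box a b :: 'a set))"
    by (auto simp: Int_stable_def box_Int_box)
  moreover have "(range (\<lambda>(a, b). box a b :: 'a set)) \<subseteq> Pow UNIV"
    by auto
  moreover have "A \<in> sigma_sets UNIV (range (\<lambda>(a, b). box a b))"
    using \<open>A \<in> sets lborel\<close> by (simp add: borel_eq_box)
  ultimately show "(LINT x:A|lborel. f x) = 0"
  proof (induction rule: sigma_sets_induct_disjoint)
    case (basic A)
    then show ?case using box by auto
  next
    case empty
    show ?case by (simp add: set_lebesgue_integral_def)
  next
    case (compl A)
    then have "A \<in> sets borel" by (simp add: borel_eq_box)
    then have "(LINT x:A \<union> (UNIV - A)|lborel. f x) = (LINT x:A|lborel. f x) + (LINT x:UNIV - A|lborel. f x)"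
      by (intro set_integral_Un int) auto
    then show ?case using compl.IH all by (simp add: set_lebesgue_integral_def)
  next
    case (union F)
    then have "F i \<in> sets borel" for i by (auto simp: borel_eq_box subset_eq)
    moreover have "F i \<inter> F j = {}" if "i \<noteq> j" for i j
      using union.hyps(1) that by (auto simp: disjoint_family_on_def)
    ultimately show ?case
      using union.IH by (subst lebesgue_integral_countable_add) (auto intro!: int)
  qed
qed

text \<open>
  Testing with the bumps shows that all integrals over boxes vanish whose closure lies in \<open>\<Omega>\<close>.  Cut
  off to one such box, the function therefore has vanishing integral over every box, hence is zero
  there almost everywhere; countably many of these boxes exhaust \<open>\<Omega>\<close>.
\<close>

theorem fundamental_lemma_of_calculus_of_variations:
  fixes w :: "real^'n::finite \<Rightarrow> real"
  assumes "open \<Omega>" "w \<in> L2 \<Omega>"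
    and "\<forall>\<psi>\<in>test_functions \<Omega>. (LINT x|lebesgue_on \<Omega>. w x * \<psi> x) = 0"
  shows "AE x in lebesgue_on \<Omega>. w x = 0"
proof -
  note box_0 = box_integral_eq_0[OF assms]
  have [simp]: "\<Omega> \<inter> space lebesgue \<in> sets lebesgue" "\<Omega> \<in> sets lebesgue" using assms(1) by auto
  have local: "AE x in lebesgue. x \<in> cbox c d \<longrightarrow> w x = 0" if cd: "cbox c d \<subseteq> \<Omega>" for c d
  proof -
    define w0 where "w0 x = indicator \<Omega> x *\<^sub>R (w x * indicator (box c d) x)" for x
    have w0: "integrable lebesgue w0"
      using box_0(1)[OF cd] unfolding w0_def by (simp add: integrable_restrict_space)
    \<comment> \<open>The Dynkin argument runs over Borel sets, hence the passage to a Borel representative.\<close>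
    then obtain w' where w': "w' \<in> borel_measurable lborel" and eq: "AE x in lborel. w0 x = w' x"
      using completion_ex_borel_measurable_real[of w0 lborel] by (auto simp: integrable_iff_bounded)
    have w'_l: "w' \<in> borel_measurable lebesgue" using w' by (rule measurable_completion)
    have "integrable lebesgue w'"
      using w0 by (rule integrable_cong_AE_imp) (use w'_l AE_completion[OF eq] in auto)
    then have int: "integrable lborel w'" using w' integrable_completion by blast
    have set: "(LINT x:A|lborel. w' x) = (LINT x|lebesgue. indicator A x *\<^sub>R w0 x)"
      if [measurable]: "A \<in> sets borel" for A
    proof -
      note [measurable] = w'
      have "(LINT x:A|lborel. w' x) = (LINT x|lebesgue. indicator A x *\<^sub>R w' x)"
        unfolding set_lebesgue_integral_def by (subst integral_completion) measurable
      also have "\<dots> = (LINT x|lebesgue. indicator A x *\<^sub>R w0 x)"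
      proof (rule integral_cong_AE)
        have A: "A \<in> sets lebesgue" by simp
        note [measurable] = w'_l borel_measurable_integrable[OF w0]
        show "(\<lambda>x. indicator A x *\<^sub>R w' x) \<in> borel_measurable lebesgue"
          "(\<lambda>x. indicator A x *\<^sub>R w0 x) \<in> borel_measurable lebesgue"
          using A by measurable
        show "AE x in lebesgue. indicator A x *\<^sub>R w' x = indicator A x *\<^sub>R w0 x"
          using AE_completion[OF eq] by eventually_elim simp
      qed
      finally show ?thesis .
    qed
    have boxes: "(LINT x:box a b|lborel. w' x) = 0" for a b
    proof -
      obtain e f where ef: "box c d \<inter> box a b = box e f" by (auto simp: box_Int_box)
      have "(LINT x:box a b|lborel. w' x)
          = (LINT x|lebesgue. indicator \<Omega> x *\<^sub>R (w x * indicator (box e f) x))"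
        unfolding set[OF borel_open[OF open_box]] ef[symmetric] w0_def
        by (intro Bochner_Integration.integral_cong) (auto simp: indicator_def)
      also have "\<dots> = 0"
      \<comment> \<open>Only a nonempty open box determines its closed box, as its closure.\<close>
      proof (cases "box e f = {}")
        case False
        then have "cbox e f = closure (box e f)" by (simp add: closure_box)
        also have "\<dots> \<subseteq> cbox c d"
          using ef box_subset_cbox[of c d] by (intro closure_minimal) auto
        finally show ?thesis
          using box_0(2)[of e f] cd by (simp add: integral_restrict_space)
      qed simp
      finally show ?thesis .
    qed
    have "(LINT x|lborel. w' x) = (LINT x:UNIV|lborel. w' x)"
      by (simp add: set_lebesgue_integral_def)
    also have "\<dots> = (LINT x|lebesgue. w0 x)" by (subst set) auto
    also have "\<dots> = (LINT x|lebesgue. indicator (box c d) x *\<^sub>R w0 x)"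
      by (intro Bochner_Integration.integral_cong) (auto simp: w0_def indicator_def)
    also have "\<dots> = (LINT x:box c d|lborel. w' x)" by (rule set[symmetric]) simp
    finally have "(LINT x|lborel. w' x) = 0" by (simp add: boxes)
    from AE_eq_0_if_box_integrals_0[OF int this boxes] eq
    have "AE x in lborel. w0 x = 0" by eventually_elim simp
    then have "AE x in lebesgue. w0 x = 0" by (rule AE_completion)
    moreover have "AE x in lebesgue. x \<notin> cbox c d - box c d"
      using negligible_frontier_interval[of c d] by (intro AE_not_in) (simp add: negligible_iff_null_sets)
    ultimately show ?thesis
      by eventually_elim (use cd box_subset_cbox[of c d] in \<open>auto simp: w0_def indicator_def\<close>)
  qed
  obtain \<D> where D: "countable \<D>" "\<D> \<subseteq> Pow \<Omega>" "\<And>X. X \<in> \<D> \<Longrightarrow> \<exists>a b. X = cbox a b" "\<Union>\<D> = \<Omega>"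
    using open_countable_Union_open_cbox[OF assms(1)] by metis
  have "AE x in lebesgue. \<forall>X\<in>\<D>. x \<in> X \<longrightarrow> w x = 0"
    using D(1,2,3) local by (intro AE_ball_countable') (auto, blast)
  then have "AE x in lebesgue. x \<in> \<Omega> \<longrightarrow> w x = 0"
    by eventually_elim (use D(4) in blast)
  then show ?thesis by (simp add: AE_restrict_space_iff)
qed

section \<open>Weak derivatives\<close>

lemma has_weak_partialD:
  assumes "has_weak_partial \<Omega> i u w" "\<psi> \<in> test_functions \<Omega>"
  shows "(LINT x|lebesgue_on \<Omega>. u x * partial i \<psi> x) = - (LINT x|lebesgue_on \<Omega>. w x * \<psi> x)"
  using assms by (simp add: has_weak_partial_def)

lemma has_weak_partial_diff:
  assumes "open \<Omega>" and L2: "u \<in> L2 \<Omega>" "v \<in> L2 \<Omega>" "w \<in> L2 \<Omega>" "z \<in> L2 \<Omega>"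
    and "has_weak_partial \<Omega> i u w" "has_weak_partial \<Omega> i v z"
  shows "has_weak_partial \<Omega> i (\<lambda>x. u x - v x) (\<lambda>x. w x - z x)"
  unfolding has_weak_partial_def
proof
  fix \<psi> assume \<psi>: "\<psi> \<in> test_functions \<Omega>"
  have split: "(LINT x|lebesgue_on \<Omega>. (f x - g x) * \<eta> x)
      = (LINT x|lebesgue_on \<Omega>. f x * \<eta> x) - (LINT x|lebesgue_on \<Omega>. g x * \<eta> x)"
    if "f \<in> L2 \<Omega>" "g \<in> L2 \<Omega>" "\<eta> \<in> test_functions \<Omega>" for f g \<eta>
    using that test_functions_L2[OF assms(1)]
    by (simp add: left_diff_distrib L2_mult_integrable)
  show "(LINT x|lebesgue_on \<Omega>. (u x - v x) * partial i \<psi> x)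
      = - (LINT x|lebesgue_on \<Omega>. (w x - z x) * \<psi> x)"
    using \<psi> L2 assms(6,7)[THEN has_weak_partialD, OF \<psi>]
    by (simp add: split test_functions_partial)
qed

text \<open>
  Uniqueness is what gives the chosen representative \<^const>\<open>weak_partial\<close> any properties: by it, each
  rule for weak derivatives becomes an equation that holds almost everywhere.
\<close>

lemma has_weak_partial_unique:
  assumes "open \<Omega>" "w \<in> L2 \<Omega>" "z \<in> L2 \<Omega>" "has_weak_partial \<Omega> i u w" "has_weak_partial \<Omega> i u z"
  shows "AE x in lebesgue_on \<Omega>. w x = z x"
proof -
  have "AE x in lebesgue_on \<Omega>. w x - z x = 0"
  proof (rule fundamental_lemma_of_calculus_of_variations[OF assms(1)])
    show "\<forall>\<psi>\<in>test_functions \<Omega>. (LINT x|lebesgue_on \<Omega>. (w x - z x) * \<psi> x) = 0"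
    proof
      fix \<psi> assume "\<psi> \<in> test_functions \<Omega>"
      then show "(LINT x|lebesgue_on \<Omega>. (w x - z x) * \<psi> x) = 0"
        using assms(4,5)[THEN has_weak_partialD] assms(2,3) test_functions_L2[OF assms(1)]
        by (simp add: left_diff_distrib L2_mult_integrable)
    qed
  qed (use assms in \<open>simp add: L2_diff\<close>)
  then show ?thesis by simp
qed

lemma has_weak_partial_cong_AE:
  assumes "u \<in> L2 \<Omega>" "v \<in> L2 \<Omega>" "AE x in lebesgue_on \<Omega>. u x = v x" "has_weak_partial \<Omega> i u w"
  shows "has_weak_partial \<Omega> i v w"
  unfolding has_weak_partial_def
proof
  fix \<psi> assume \<psi>: "\<psi> \<in> test_functions \<Omega>"
  note [measurable] = assms(1,2)[THEN L2_measurable]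
    test_functions_measurable[OF test_functions_partial[OF \<psi>]]
  have "(LINT x|lebesgue_on \<Omega>. v x * partial i \<psi> x) = (LINT x|lebesgue_on \<Omega>. u x * partial i \<psi> x)"
  proof (rule integral_cong_AE)
    show "AE x in lebesgue_on \<Omega>. v x * partial i \<psi> x = u x * partial i \<psi> x"
      using assms(3) by eventually_elim simp
  qed measurable
  then show "(LINT x|lebesgue_on \<Omega>. v x * partial i \<psi> x) = - (LINT x|lebesgue_on \<Omega>. w x * \<psi> x)"
    using has_weak_partialD[OF assms(4) \<psi>] by simp
qed

lemma has_weak_partial_test_function:
  assumes "open \<Omega>" "\<psi> \<in> test_functions \<Omega>"
  shows "has_weak_partial \<Omega> i \<psi> (partial i \<psi>)"
  unfolding has_weak_partial_def
proof
  fix \<eta> assume \<eta>: "\<eta> \<in> test_functions \<Omega>"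
  have "0 = (LINT x|lebesgue_on \<Omega>. partial i (\<lambda>x. \<psi> x * \<eta> x) x)"
    using integral_partial_eq_0[OF assms(1) test_functions_mult[OF assms(2) test_functions_Ck[OF \<eta>]]]
    by simp
  also have "\<dots> = (LINT x|lebesgue_on \<Omega>. \<psi> x * partial i \<eta> x + partial i \<psi> x * \<eta> x)"
    using \<eta> assms(2) by (simp add: partial_mult test_functions_differentiable)
  also have "\<dots> = (LINT x|lebesgue_on \<Omega>. \<psi> x * partial i \<eta> x) + (LINT x|lebesgue_on \<Omega>. partial i \<psi> x * \<eta> x)"
    using assms \<eta>
    by (intro Bochner_Integration.integral_add L2_mult_integrable test_functions_L2 test_functions_partial)
  finally show "(LINT x|lebesgue_on \<Omega>. \<psi> x * partial i \<eta> x)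
      = - (LINT x|lebesgue_on \<Omega>. partial i \<psi> x * \<eta> x)" by simp
qed

lemma
  assumes "w \<in> L2 \<Omega>" "has_weak_partial \<Omega> i u w"
  shows weak_partial_L2: "weak_partial \<Omega> i u \<in> L2 \<Omega>"
    and has_weak_partial_weak_partial: "has_weak_partial \<Omega> i u (weak_partial \<Omega> i u)"
  using someI[of "\<lambda>w. w \<in> L2 \<Omega> \<and> has_weak_partial \<Omega> i u w" w] assms
  by (auto simp: weak_partial_def)

lemma weak_partial_eq_AE:
  assumes "open \<Omega>" "w \<in> L2 \<Omega>" "has_weak_partial \<Omega> i u w"
  shows "AE x in lebesgue_on \<Omega>. weak_partial \<Omega> i u x = w x"
  using assms weak_partial_L2 has_weak_partial_weak_partial
  by (intro has_weak_partial_unique[of \<Omega> _ _ i u]) auto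

lemma Hm_subset_L2: "Hm m \<Omega> \<subseteq> L2 \<Omega>"
  by (cases m) auto

lemma Hm_cong_AE:
  assumes "u \<in> Hm m \<Omega>" "v \<in> L2 \<Omega>" "AE x in lebesgue_on \<Omega>. u x = v x"
  shows "v \<in> Hm m \<Omega>"
  using assms has_weak_partial_cong_AE[of u \<Omega> v] by (cases m) (auto, blast)

lemma Hm_diff:
  assumes "open \<Omega>"
  shows "u \<in> Hm m \<Omega> \<Longrightarrow> v \<in> Hm m \<Omega> \<Longrightarrow> (\<lambda>x. u x - v x) \<in> Hm m \<Omega>"
proof (induction m arbitrary: u v)
  case 0
  then show ?case by (simp add: L2_diff)
next
  case (Suc m)
  have "\<exists>w\<in>Hm m \<Omega>. has_weak_partial \<Omega> i (\<lambda>x. u x - v x) w" for i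
  proof -
    obtain w z where "w \<in> Hm m \<Omega>" "has_weak_partial \<Omega> i u w" "z \<in> Hm m \<Omega>" "has_weak_partial \<Omega> i v z"
      using Suc.prems unfolding Hm.simps by blast
    moreover have "u \<in> L2 \<Omega>" "v \<in> L2 \<Omega>" "w \<in> L2 \<Omega>" "z \<in> L2 \<Omega>"
      using Suc.prems calculation Hm_subset_L2[of m \<Omega>] by auto
    ultimately show ?thesis
      using Suc.IH has_weak_partial_diff[OF assms] by blast
  qed
  then show ?case using Suc.prems by (auto intro: L2_diff)
qed

lemma
  assumes "open \<Omega>" "u \<in> Hm (Suc m) \<Omega>"
  shows Hm_weak_partial: "weak_partial \<Omega> i u \<in> Hm m \<Omega>"
    and Hm_has_weak_partial: "has_weak_partial \<Omega> i u (weak_partial \<Omega> i u)"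
proof -
  obtain w where w: "w \<in> Hm m \<Omega>" "has_weak_partial \<Omega> i u w" using assms(2) by auto
  then have L2: "w \<in> L2 \<Omega>" using Hm_subset_L2 by auto
  show "has_weak_partial \<Omega> i u (weak_partial \<Omega> i u)"
    using has_weak_partial_weak_partial[OF L2 w(2)] .
  have "AE x in lebesgue_on \<Omega>. w x = weak_partial \<Omega> i u x"
    using weak_partial_eq_AE[OF assms(1) L2 w(2)] by eventually_elim simp
  with w(1) weak_partial_L2[OF L2 w(2)] show "weak_partial \<Omega> i u \<in> Hm m \<Omega>"
    by (rule Hm_cong_AE)
qed

lemma weak_partial_in_L2: "open \<Omega> \<Longrightarrow> u \<in> Hm (Suc m) \<Omega> \<Longrightarrow> weak_partial \<Omega> i u \<in> L2 \<Omega>"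
  using Hm_weak_partial Hm_subset_L2 by blast

lemma weak_partial_diff_AE:
  assumes "open \<Omega>" "u \<in> Hm (Suc m) \<Omega>" "v \<in> Hm (Suc m) \<Omega>"
  shows "AE x in lebesgue_on \<Omega>.
    weak_partial \<Omega> i (\<lambda>x. u x - v x) x = weak_partial \<Omega> i u x - weak_partial \<Omega> i v x"
proof (rule weak_partial_eq_AE[OF assms(1)])
  note L2 = assms(2,3)[THEN weak_partial_in_L2[OF assms(1)]]
  show "(\<lambda>x. weak_partial \<Omega> i u x - weak_partial \<Omega> i v x) \<in> L2 \<Omega>" by (intro L2_diff L2)
  show "has_weak_partial \<Omega> i (\<lambda>x. u x - v x) (\<lambda>x. weak_partial \<Omega> i u x - weak_partial \<Omega> i v x)"
    using assms Hm_subset_L2[of "Suc m" \<Omega>] L2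
    by (intro has_weak_partial_diff Hm_has_weak_partial[where m = m]) auto
qed

lemma test_function_Hm:
  assumes "open \<Omega>"
  shows "\<psi> \<in> test_functions \<Omega> \<Longrightarrow> \<psi> \<in> Hm m \<Omega>"
proof (induction m arbitrary: \<psi>)
  case (Suc m)
  then show ?case
    using has_weak_partial_test_function[OF assms] test_functions_partial test_functions_L2[OF assms]
    by auto blast
qed (simp add: test_functions_L2[OF assms])

lemma weak_partial_test_function_AE:
  assumes "open \<Omega>" "\<psi> \<in> test_functions \<Omega>"
  shows "AE x in lebesgue_on \<Omega>. weak_partial \<Omega> i \<psi> x = partial i \<psi> x"
  using assms
  by (intro weak_partial_eq_AE has_weak_partial_test_function test_functions_L2 test_functions_partial)

text \<open>
  An integration by parts turns the weak formulation of \<open>- \<Delta> u = r\<close> for a function that is already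
  in \<open>H\<^sup>2\<close> into an identity between functions, again by the fundamental lemma.
\<close>

lemma weak_poisson_imp_strong:
  assumes "open \<Omega>" and u: "u \<in> Hm 2 \<Omega>" and r: "r \<in> L2 \<Omega>"
    and weak: "\<And>\<psi>. \<psi> \<in> test_functions \<Omega> \<Longrightarrow>
      (\<Sum>j\<in>UNIV. LINT x|lebesgue_on \<Omega>. weak_partial \<Omega> j u x * partial j \<psi> x)
        = (LINT x|lebesgue_on \<Omega>. r x * \<psi> x)"
  shows "AE x in lebesgue_on \<Omega>. - (\<Sum>j\<in>UNIV. weak_partial \<Omega> j (weak_partial \<Omega> j u) x) = r x"
proof -
  define lap where "lap x = (\<Sum>j\<in>UNIV. weak_partial \<Omega> j (weak_partial \<Omega> j u) x)" for x
  have u': "weak_partial \<Omega> j u \<in> Hm (Suc 0) \<Omega>" for j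
    using u assms(1) by (intro Hm_weak_partial) (simp_all add: numeral_2_eq_2)
  have L2: "weak_partial \<Omega> j (weak_partial \<Omega> j u) \<in> L2 \<Omega>" for j
    using weak_partial_in_L2[OF assms(1) u'] .
  have lap: "lap \<in> L2 \<Omega>" unfolding lap_def by (rule L2_sum) (rule L2)
  have "AE x in lebesgue_on \<Omega>. lap x + r x = 0"
  proof (rule fundamental_lemma_of_calculus_of_variations[OF assms(1)])
    show "(\<lambda>x. lap x + r x) \<in> L2 \<Omega>" using lap r by (rule L2_add)
    show "\<forall>\<psi>\<in>test_functions \<Omega>. (LINT x|lebesgue_on \<Omega>. (lap x + r x) * \<psi> x) = 0"
    proof
      fix \<psi> assume \<psi>: "\<psi> \<in> test_functions \<Omega>"
      note \<psi>_L2 = test_functions_L2[OF assms(1) \<psi>]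
      have "(LINT x|lebesgue_on \<Omega>. lap x * \<psi> x)
          = (\<Sum>j\<in>UNIV. LINT x|lebesgue_on \<Omega>. weak_partial \<Omega> j (weak_partial \<Omega> j u) x * \<psi> x)"
        unfolding lap_def sum_distrib_right
        by (intro Bochner_Integration.integral_sum L2_mult_integrable L2 \<psi>_L2)
      also have "\<dots> = (\<Sum>j\<in>UNIV. - (LINT x|lebesgue_on \<Omega>. weak_partial \<Omega> j u x * partial j \<psi> x))"
        by (intro sum.cong refl) (simp add: has_weak_partialD[OF Hm_has_weak_partial[OF assms(1) u'] \<psi>])
      also have "\<dots> = - (LINT x|lebesgue_on \<Omega>. r x * \<psi> x)"
        using weak[OF \<psi>] by (simp add: sum_negf)
      finally show "(LINT x|lebesgue_on \<Omega>. (lap x + r x) * \<psi> x) = 0"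
        using L2_mult_integrable[OF lap \<psi>_L2] L2_mult_integrable[OF r \<psi>_L2]
        by (simp add: distrib_right)
    qed
  qed
  then show ?thesis unfolding lap_def by eventually_elim simp
qed

section \<open>The space of functions with zero boundary values\<close>

lemma L2_norm_square: "(L2_norm \<Omega> u)\<^sup>2 = (LINT x|lebesgue_on \<Omega>. (norm (u x))\<^sup>2)"
  by (simp add: L2_norm_def Bochner_Integration.integral_nonneg)

lemma H1_norm_square:
  "(H1_norm \<Omega> u)\<^sup>2 = (L2_norm \<Omega> u)\<^sup>2 + (\<Sum>i\<in>UNIV. (L2_norm \<Omega> (weak_partial \<Omega> i u))\<^sup>2)"
  by (simp add: H1_norm_def add_nonneg_nonneg sum_nonneg)

lemma L2_norm_cong_AE:
  assumes "u \<in> L2 \<Omega>" "v \<in> L2 \<Omega>" "AE x in lebesgue_on \<Omega>. \<bar>u x\<bar> = \<bar>v x\<bar>"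
  shows "L2_norm \<Omega> u = L2_norm \<Omega> v"
proof -
  note [measurable] = assms(1,2)[THEN L2_measurable]
  have "(LINT x|lebesgue_on \<Omega>. (norm (u x))\<^sup>2) = (LINT x|lebesgue_on \<Omega>. (norm (v x))\<^sup>2)"
  proof (rule integral_cong_AE)
    show "AE x in lebesgue_on \<Omega>. (norm (u x))\<^sup>2 = (norm (v x))\<^sup>2"
      using assms(3) by eventually_elim (simp only: real_norm_def)
  qed measurable
  then show ?thesis by (simp add: L2_norm_def)
qed

text \<open>
  For squared norms the triangle inequality costs a factor two, which convergence to zero tolerates;
  in return it follows from a pointwise estimate.
\<close>

lemma L2_norm_square_triangle:
  assumes "u \<in> L2 \<Omega>" "v \<in> L2 \<Omega>"
  shows "(L2_norm \<Omega> u)\<^sup>2 \<le> 2 * (L2_norm \<Omega> (\<lambda>x. u x - v x))\<^sup>2 + 2 * (L2_norm \<Omega> v)\<^sup>2"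
proof -
  have "(LINT x|lebesgue_on \<Omega>. (u x)\<^sup>2)
      \<le> (LINT x|lebesgue_on \<Omega>. 2 * (u x - v x)\<^sup>2 + 2 * (v x)\<^sup>2)"
  proof (rule integral_mono)
    fix x
    have "0 \<le> (u x - 2 * v x)\<^sup>2" by simp
    then show "(u x)\<^sup>2 \<le> 2 * (u x - v x)\<^sup>2 + 2 * (v x)\<^sup>2"
      by (simp add: power2_eq_square algebra_simps)
  qed (intro Bochner_Integration.integrable_add integrable_mult_right L2_square_integrable L2_diff assms)+
  also have "\<dots> = 2 * (LINT x|lebesgue_on \<Omega>. (u x - v x)\<^sup>2) + 2 * (LINT x|lebesgue_on \<Omega>. (v x)\<^sup>2)"
    using L2_square_integrable[OF L2_diff[OF assms]] L2_square_integrable[OF assms(2)] by simp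
  finally show ?thesis by (simp add: L2_norm_square)
qed

lemma L2_norm_square_diff_le:
  assumes "u \<in> L2 \<Omega>" "v \<in> L2 \<Omega>"
  shows "(L2_norm \<Omega> (\<lambda>x. u x - v x))\<^sup>2 \<le> 2 * (L2_norm \<Omega> u)\<^sup>2 + 2 * (L2_norm \<Omega> v)\<^sup>2"
  using L2_norm_square_triangle[OF L2_diff[OF assms] L2_cmult[OF assms(2), of "-1"]]
  by (simp add: L2_norm_def)

lemma H1_norm_square_diff_le:
  assumes "open \<Omega>" "u \<in> Hm 1 \<Omega>" "v \<in> Hm 1 \<Omega>"
  shows "(H1_norm \<Omega> (\<lambda>x. u x - v x))\<^sup>2 \<le> 2 * (H1_norm \<Omega> u)\<^sup>2 + 2 * (H1_norm \<Omega> v)\<^sup>2"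
proof -
  have uv: "u \<in> Hm (Suc 0) \<Omega>" "v \<in> Hm (Suc 0) \<Omega>" using assms by simp_all
  note L2 = uv[THEN weak_partial_in_L2[OF assms(1)]]
  have "(L2_norm \<Omega> (weak_partial \<Omega> i (\<lambda>x. u x - v x)))\<^sup>2
      \<le> 2 * (L2_norm \<Omega> (weak_partial \<Omega> i u))\<^sup>2 + 2 * (L2_norm \<Omega> (weak_partial \<Omega> i v))\<^sup>2" for i
  proof -
    have "L2_norm \<Omega> (weak_partial \<Omega> i (\<lambda>x. u x - v x))
        = L2_norm \<Omega> (\<lambda>x. weak_partial \<Omega> i u x - weak_partial \<Omega> i v x)"
    proof (rule L2_norm_cong_AE)
      show "weak_partial \<Omega> i (\<lambda>x. u x - v x) \<in> L2 \<Omega>"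
        by (rule weak_partial_in_L2[OF assms(1) Hm_diff[OF assms(1) uv]])
      show "AE x in lebesgue_on \<Omega>. \<bar>weak_partial \<Omega> i (\<lambda>x. u x - v x) x\<bar>
          = \<bar>weak_partial \<Omega> i u x - weak_partial \<Omega> i v x\<bar>"
        using weak_partial_diff_AE[OF assms(1) uv, of i] by eventually_elim simp
    qed (intro L2_diff L2)
    then show ?thesis using L2_norm_square_diff_le[OF L2] by simp
  qed
  then have "(\<Sum>i\<in>UNIV. (L2_norm \<Omega> (weak_partial \<Omega> i (\<lambda>x. u x - v x)))\<^sup>2)
      \<le> (\<Sum>i\<in>UNIV. 2 * (L2_norm \<Omega> (weak_partial \<Omega> i u))\<^sup>2 + 2 * (L2_norm \<Omega> (weak_partial \<Omega> i v))\<^sup>2)"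
    by (rule sum_mono)
  moreover have "(L2_norm \<Omega> (\<lambda>x. u x - v x))\<^sup>2 \<le> 2 * (L2_norm \<Omega> u)\<^sup>2 + 2 * (L2_norm \<Omega> v)\<^sup>2"
    using uv Hm_subset_L2[of "Suc 0" \<Omega>] by (intro L2_norm_square_diff_le) auto
  ultimately show ?thesis
    by (simp add: H1_norm_square sum.distrib sum_distrib_left distrib_left)
qed

lemma H10_diff:
  assumes "open \<Omega>" "u \<in> H10 \<Omega>" "v \<in> H10 \<Omega>"
  shows "(\<lambda>x. u x - v x) \<in> H10 \<Omega>"
proof -
  obtain \<psi> \<eta> where \<psi>: "\<And>n. \<psi> n \<in> test_functions \<Omega>" "(\<lambda>n. H1_norm \<Omega> (\<lambda>x. u x - \<psi> n x)) \<longlonglongrightarrow> 0"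
    and \<eta>: "\<And>n. \<eta> n \<in> test_functions \<Omega>" "(\<lambda>n. H1_norm \<Omega> (\<lambda>x. v x - \<eta> n x)) \<longlonglongrightarrow> 0"
    using assms(2,3) by (auto simp: H10_def)
  have uv: "u \<in> Hm 1 \<Omega>" "v \<in> Hm 1 \<Omega>" using assms(2,3) by (auto simp: H10_def)
  have "(\<lambda>n. (H1_norm \<Omega> (\<lambda>x. u x - v x - (\<psi> n x - \<eta> n x)))\<^sup>2) \<longlonglongrightarrow> 0"
  proof (rule tendsto_sandwich[OF _ _ tendsto_const])
    have "(\<lambda>n. 2 * (H1_norm \<Omega> (\<lambda>x. u x - \<psi> n x))\<^sup>2 + 2 * (H1_norm \<Omega> (\<lambda>x. v x - \<eta> n x))\<^sup>2)
        \<longlonglongrightarrow> 2 * 0\<^sup>2 + 2 * 0\<^sup>2"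
      by (intro tendsto_intros \<psi> \<eta>)
    then show "(\<lambda>n. 2 * (H1_norm \<Omega> (\<lambda>x. u x - \<psi> n x))\<^sup>2 + 2 * (H1_norm \<Omega> (\<lambda>x. v x - \<eta> n x))\<^sup>2)
        \<longlonglongrightarrow> 0" by simp
    show "\<forall>\<^sub>F n in sequentially. (H1_norm \<Omega> (\<lambda>x. u x - v x - (\<psi> n x - \<eta> n x)))\<^sup>2
        \<le> 2 * (H1_norm \<Omega> (\<lambda>x. u x - \<psi> n x))\<^sup>2 + 2 * (H1_norm \<Omega> (\<lambda>x. v x - \<eta> n x))\<^sup>2"
    proof (rule always_eventually, rule allI)
      fix n
      have "(\<lambda>x. u x - v x - (\<psi> n x - \<eta> n x)) = (\<lambda>x. (u x - \<psi> n x) - (v x - \<eta> n x))"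
        by (simp add: algebra_simps)
      then show "(H1_norm \<Omega> (\<lambda>x. u x - v x - (\<psi> n x - \<eta> n x)))\<^sup>2
        \<le> 2 * (H1_norm \<Omega> (\<lambda>x. u x - \<psi> n x))\<^sup>2 + 2 * (H1_norm \<Omega> (\<lambda>x. v x - \<eta> n x))\<^sup>2"
        using H1_norm_square_diff_le[OF assms(1) Hm_diff[OF assms(1) uv(1) test_function_Hm[OF assms(1) \<psi>(1)]]
            Hm_diff[OF assms(1) uv(2) test_function_Hm[OF assms(1) \<eta>(1)]], of n n] by simp
    qed
  qed simp
  then have "(\<lambda>n. H1_norm \<Omega> (\<lambda>x. u x - v x - (\<psi> n x - \<eta> n x))) \<longlonglongrightarrow> 0"
    by simp
  then show ?thesis
    unfolding H10_def using Hm_diff[OF assms(1) uv] test_functions_diff[OF \<psi>(1) \<eta>(1)]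
    by (auto intro!: exI[of _ "\<lambda>n x. \<psi> n x - \<eta> n x"])
qed

lemma test_function_H10:
  assumes "open \<Omega>" "\<psi> \<in> test_functions \<Omega>"
  shows "\<psi> \<in> H10 \<Omega>"
proof -
  have "L2_norm \<Omega> (weak_partial \<Omega> i (\<lambda>x. 0)) = L2_norm \<Omega> (\<lambda>x. 0::real)" for i
  proof (rule L2_norm_cong_AE[OF _ L2_0])
    show "weak_partial \<Omega> i (\<lambda>x. 0) \<in> L2 \<Omega>"
      using weak_partial_in_L2[OF assms(1) test_function_Hm[OF assms(1) test_functions_0]] .
    show "AE x in lebesgue_on \<Omega>. \<bar>weak_partial \<Omega> i (\<lambda>x. 0) x\<bar> = \<bar>0\<bar>"
      using weak_partial_test_function_AE[OF assms(1) test_functions_0, of i]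
      by eventually_elim (simp add: partial_const)
  qed
  then have "H1_norm \<Omega> (\<lambda>x. 0) = 0" by (simp add: H1_norm_def L2_norm_def)
  then have "(\<lambda>n::nat. H1_norm \<Omega> (\<lambda>x. \<psi> x - \<psi> x)) \<longlonglongrightarrow> 0" by simp
  then show ?thesis
    unfolding H10_def using assms test_function_Hm[OF assms, of 1]
    by (auto intro!: exI[of _ "\<lambda>n. \<psi>"] simp del: Hm.simps One_nat_def)
qed

text \<open>
  The derivative of \<open>x\<^sub>i \<psi>\<^sup>2\<close> in direction \<open>i\<close> is \<open>\<psi>\<^sup>2 + 2 x\<^sub>i \<psi> \<partial>\<^sub>i \<psi>\<close> and has integral zero; the
  mixed term is at most \<open>\<psi>\<^sup>2 / 2 + 2 R\<^sup>2 (\<partial>\<^sub>i \<psi>)\<^sup>2\<close>, whose first summand is absorbed.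
\<close>

lemma poincare_test_function:
  fixes \<psi> :: "real^'n::finite \<Rightarrow> real"
  assumes "open \<Omega>" and R: "\<And>x. x \<in> \<Omega> \<Longrightarrow> norm x \<le> R" and \<psi>: "\<psi> \<in> test_functions \<Omega>"
  shows "(L2_norm \<Omega> \<psi>)\<^sup>2 \<le> 4 * R\<^sup>2 * (L2_norm \<Omega> (partial i \<psi>))\<^sup>2"
proof -
  define \<psi>' where "\<psi>' = partial i \<psi>"
  have \<psi>': "\<psi>' \<in> test_functions \<Omega>" unfolding \<psi>'_def by (rule test_functions_partial[OF \<psi>])
  have sq: "(\<lambda>x. \<psi> x * \<psi> x) \<in> test_functions \<Omega>"
    by (rule test_functions_mult[OF \<psi> test_functions_Ck[OF \<psi>]])
  have mixed: "(\<lambda>x. \<psi> x * \<psi>' x * x $ i) \<in> test_functions \<Omega>"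
    by (rule test_functions_mult[OF test_functions_mult[OF \<psi> test_functions_Ck[OF \<psi>']] Ck_component])
  have field: "(\<lambda>x. \<psi> x * \<psi> x * x $ i) \<in> test_functions \<Omega>"
    by (rule test_functions_mult[OF sq Ck_component])
  have "partial i (\<lambda>x. \<psi> x * \<psi> x * x $ i) x = \<psi> x * \<psi> x + 2 * (\<psi> x * \<psi>' x * x $ i)" for x
  proof -
    have "(\<lambda>x. x $ i) differentiable at x" using Ck_component[of "Suc 0" i] by simp
    moreover have "partial i (\<lambda>x. x $ i) x = 1"
      by (subst partial_eq_derivative[OF bounded_linear_imp_has_derivative[OF bounded_linear_vec_nth]])
         simp
    ultimately show ?thesis
      using \<psi> sq by (simp add: partial_mult test_functions_differentiable \<psi>'_def algebra_simps)
  qed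
  then have "(LINT x|lebesgue_on \<Omega>. \<psi> x * \<psi> x + 2 * (\<psi> x * \<psi>' x * x $ i)) = 0"
    using integral_partial_eq_0[OF assms(1) field, of i] by simp
  then have eq: "(LINT x|lebesgue_on \<Omega>. \<psi> x * \<psi> x) = (LINT x|lebesgue_on \<Omega>. - 2 * (\<psi> x * \<psi>' x * x $ i))"
    using test_functions_integrable[OF assms(1) sq] test_functions_integrable[OF assms(1) mixed]
    by simp
  note int = L2_square_integrable[OF test_functions_L2[OF assms(1) \<psi>]]
    L2_square_integrable[OF test_functions_L2[OF assms(1) \<psi>']]
  have "\<dots> \<le> (LINT x|lebesgue_on \<Omega>. (\<psi> x)\<^sup>2 / 2 + 2 * R\<^sup>2 * (\<psi>' x)\<^sup>2)"
  proof (rule integral_mono)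
    show "integrable (lebesgue_on \<Omega>) (\<lambda>x. - 2 * (\<psi> x * \<psi>' x * x $ i))"
      using test_functions_integrable[OF assms(1) mixed] by simp
    show "integrable (lebesgue_on \<Omega>) (\<lambda>x. (\<psi> x)\<^sup>2 / 2 + 2 * R\<^sup>2 * (\<psi>' x)\<^sup>2)"
      using int by simp
    fix x assume "x \<in> space (lebesgue_on \<Omega>)"
    then have "\<bar>x $ i\<bar> \<le> R" using R[of x] component_le_norm_cart[of x i] by simp
    then have "(x $ i)\<^sup>2 \<le> R\<^sup>2" by (metis abs_ge_zero power2_abs power_mono)
    then have "(x $ i)\<^sup>2 * (\<psi>' x)\<^sup>2 \<le> R\<^sup>2 * (\<psi>' x)\<^sup>2" by (rule mult_right_mono) simp
    moreover have "0 \<le> (\<psi> x + 2 * (\<psi>' x * x $ i))\<^sup>2" by simp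
    then have "- 2 * (\<psi> x * \<psi>' x * x $ i) \<le> (\<psi> x)\<^sup>2 / 2 + 2 * ((x $ i)\<^sup>2 * (\<psi>' x)\<^sup>2)"
      by (simp add: power2_eq_square algebra_simps)
    ultimately show "- 2 * (\<psi> x * \<psi>' x * x $ i) \<le> (\<psi> x)\<^sup>2 / 2 + 2 * R\<^sup>2 * (\<psi>' x)\<^sup>2"
      by linarith
  qed
  also have "\<dots> = (LINT x|lebesgue_on \<Omega>. (\<psi> x)\<^sup>2) / 2 + 2 * R\<^sup>2 * (LINT x|lebesgue_on \<Omega>. (\<psi>' x)\<^sup>2)"
    using int by simp
  finally show ?thesis
    unfolding L2_norm_square real_norm_def power2_abs \<psi>'_def[symmetric]
    using eq by (simp only: power2_eq_square)
qed

text \<open>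
  The estimate extends to the closure of the test functions; applying the factor-two triangle
  inequality once to \<open>u\<close> and once to its derivative turns the constant \<open>4 R\<^sup>2\<close> into \<open>16 R\<^sup>2\<close>.
\<close>

theorem poincare_inequality:
  fixes u :: "real^'n::finite \<Rightarrow> real"
  assumes "open \<Omega>" and R: "\<And>x. x \<in> \<Omega> \<Longrightarrow> norm x \<le> R" and u: "u \<in> H10 \<Omega>"
  shows "(L2_norm \<Omega> u)\<^sup>2 \<le> 16 * R\<^sup>2 * (L2_norm \<Omega> (weak_partial \<Omega> i u))\<^sup>2"
proof -
  obtain \<psi> where \<psi>: "\<And>n. \<psi> n \<in> test_functions \<Omega>" "(\<lambda>n. H1_norm \<Omega> (\<lambda>x. u x - \<psi> n x)) \<longlonglongrightarrow> 0"
    using u by (auto simp: H10_def)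
  have u1: "u \<in> Hm (Suc 0) \<Omega>" using u by (simp add: H10_def)
  then have u0: "u \<in> L2 \<Omega>" using Hm_subset_L2 by blast
  note u' = weak_partial_in_L2[OF assms(1) u1, of i]
  have bound: "(L2_norm \<Omega> u)\<^sup>2 \<le> 16 * R\<^sup>2 * (L2_norm \<Omega> (weak_partial \<Omega> i u))\<^sup>2
      + (2 + 16 * R\<^sup>2) * (H1_norm \<Omega> (\<lambda>x. u x - \<psi> n x))\<^sup>2" for n
  proof -
    define d where "d x = u x - \<psi> n x" for x
    note \<psi>1 = test_function_Hm[OF assms(1) \<psi>(1)[of n], of "Suc 0"]
    note p = test_functions_L2[OF assms(1) test_functions_partial[OF \<psi>(1)[of n]], of i]
    have d: "d \<in> Hm (Suc 0) \<Omega>" unfolding d_def by (rule Hm_diff[OF assms(1) u1 \<psi>1])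
    have eq: "L2_norm \<Omega> (\<lambda>x. partial i (\<psi> n) x - weak_partial \<Omega> i u x) = L2_norm \<Omega> (weak_partial \<Omega> i d)"
    proof (rule L2_norm_cong_AE[OF L2_diff[OF p u'] weak_partial_in_L2[OF assms(1) d]])
      show "AE x in lebesgue_on \<Omega>. \<bar>partial i (\<psi> n) x - weak_partial \<Omega> i u x\<bar> = \<bar>weak_partial \<Omega> i d x\<bar>"
        using weak_partial_diff_AE[OF assms(1) u1 \<psi>1, of i]
          weak_partial_test_function_AE[OF assms(1) \<psi>(1)[of n], of i]
        unfolding d_def[symmetric] by eventually_elim simp
    qed
    have H1: "(L2_norm \<Omega> d)\<^sup>2 \<le> (H1_norm \<Omega> d)\<^sup>2" "(L2_norm \<Omega> (weak_partial \<Omega> i d))\<^sup>2 \<le> (H1_norm \<Omega> d)\<^sup>2"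
      using member_le_sum[of i UNIV "\<lambda>i. (L2_norm \<Omega> (weak_partial \<Omega> i d))\<^sup>2"]
      by (auto simp: H1_norm_square sum_nonneg intro: add_increasing)
    have "(L2_norm \<Omega> u)\<^sup>2 \<le> 2 * (L2_norm \<Omega> d)\<^sup>2 + 2 * (L2_norm \<Omega> (\<psi> n))\<^sup>2"
      unfolding d_def by (rule L2_norm_square_triangle[OF u0 test_functions_L2[OF assms(1) \<psi>(1)]])
    also have "\<dots> \<le> 2 * (L2_norm \<Omega> d)\<^sup>2 + 8 * R\<^sup>2 * (L2_norm \<Omega> (partial i (\<psi> n)))\<^sup>2"
      using poincare_test_function[OF assms(1) R \<psi>(1), of n i] by simp
    also have "\<dots> \<le> 2 * (L2_norm \<Omega> d)\<^sup>2 + 8 * R\<^sup>2 *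
        (2 * (L2_norm \<Omega> (weak_partial \<Omega> i d))\<^sup>2 + 2 * (L2_norm \<Omega> (weak_partial \<Omega> i u))\<^sup>2)"
      using L2_norm_square_triangle[OF p u'] unfolding eq by (intro add_left_mono mult_left_mono) auto
    also have "\<dots> \<le> 2 * (H1_norm \<Omega> d)\<^sup>2 + 8 * R\<^sup>2 *
        (2 * (H1_norm \<Omega> d)\<^sup>2 + 2 * (L2_norm \<Omega> (weak_partial \<Omega> i u))\<^sup>2)"
      using H1 by (intro add_mono mult_left_mono) auto
    finally show ?thesis by (simp add: d_def[symmetric] algebra_simps)
  qed
  have "(\<lambda>n. 16 * R\<^sup>2 * (L2_norm \<Omega> (weak_partial \<Omega> i u))\<^sup>2
      + (2 + 16 * R\<^sup>2) * (H1_norm \<Omega> (\<lambda>x. u x - \<psi> n x))\<^sup>2)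
      \<longlonglongrightarrow> 16 * R\<^sup>2 * (L2_norm \<Omega> (weak_partial \<Omega> i u))\<^sup>2 + (2 + 16 * R\<^sup>2) * 0\<^sup>2"
    by (intro tendsto_intros \<psi>)
  then show ?thesis
    using LIMSEQ_le_const[of _ _ "(L2_norm \<Omega> u)\<^sup>2"] bound by fastforce
qed

section \<open>Stability of semilinear systems\<close>

lemma weak_solution_componentwise:
  assumes "open \<Omega>" and sol: "weak_solution \<Omega> g \<epsilon> y"
    and g: "(\<lambda>x. g (y x)) \<in> product_space (L2 \<Omega>)" and \<epsilon>: "\<epsilon> \<in> product_space (L2 \<Omega>)"
    and v: "v \<in> product_space (H10 \<Omega>)"
  shows "(\<Sum>i\<in>UNIV. \<Sum>j\<in>UNIV. LINT x|lebesgue_on \<Omega>.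
        weak_partial \<Omega> j (\<lambda>x. y x $ i) x * weak_partial \<Omega> j (\<lambda>x. v x $ i) x)
      = (\<Sum>i\<in>UNIV. LINT x|lebesgue_on \<Omega>. v x $ i * (\<epsilon> x $ i - g (y x) $ i))"
proof -
  have y1: "(\<lambda>x. y x $ i) \<in> Hm (Suc 0) \<Omega>" and v1: "(\<lambda>x. v x $ i) \<in> Hm (Suc 0) \<Omega>" for i
    using sol v by (auto simp: weak_solution_def Y_space_def product_space_def H10_def)
  then have v0: "(\<lambda>x. v x $ i) \<in> L2 \<Omega>" for i using Hm_subset_L2 by blast
  have g0: "(\<lambda>x. g (y x) $ i) \<in> L2 \<Omega>" and \<epsilon>0: "(\<lambda>x. \<epsilon> x $ i) \<in> L2 \<Omega>" for i
    using g \<epsilon> by (auto simp: product_space_def)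
  note int = L2_mult_integrable[OF weak_partial_in_L2[OF assms(1) y1] weak_partial_in_L2[OF assms(1) v1]]
    L2_mult_integrable[OF v0 g0] L2_mult_integrable[OF v0 \<epsilon>0]
  have "(LINT x|lebesgue_on \<Omega>. weak_gradient \<Omega> y x \<bullet> weak_gradient \<Omega> v x)
      = (\<Sum>i\<in>UNIV. \<Sum>j\<in>UNIV. LINT x|lebesgue_on \<Omega>.
        weak_partial \<Omega> j (\<lambda>x. y x $ i) x * weak_partial \<Omega> j (\<lambda>x. v x $ i) x)"
    unfolding weak_gradient_def inner_vec_def vec_lambda_beta inner_real_def
    by (simp only: Bochner_Integration.integral_sum Bochner_Integration.integrable_sum int)
  moreover have "(LINT x|lebesgue_on \<Omega>. v x \<bullet> g (y x))
      = (\<Sum>i\<in>UNIV. LINT x|lebesgue_on \<Omega>. v x $ i * g (y x) $ i)"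
    unfolding inner_vec_def inner_real_def by (simp only: Bochner_Integration.integral_sum int)
  moreover have "(LINT x|lebesgue_on \<Omega>. v x \<bullet> \<epsilon> x)
      = (\<Sum>i\<in>UNIV. LINT x|lebesgue_on \<Omega>. v x $ i * \<epsilon> x $ i)"
    unfolding inner_vec_def inner_real_def by (simp only: Bochner_Integration.integral_sum int)
  moreover have "(\<Sum>i\<in>UNIV. LINT x|lebesgue_on \<Omega>. v x $ i * (\<epsilon> x $ i - g (y x) $ i))
      = (\<Sum>i\<in>UNIV. LINT x|lebesgue_on \<Omega>. v x $ i * \<epsilon> x $ i)
        - (\<Sum>i\<in>UNIV. LINT x|lebesgue_on \<Omega>. v x $ i * g (y x) $ i)"
    unfolding right_diff_distrib by (simp only: Bochner_Integration.integral_diff int sum_subtractf)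
  ultimately show ?thesis
    using sol v by (auto simp: weak_solution_def)
qed

lemma weak_solution_difference:
  assumes "open \<Omega>" and sol: "weak_solution \<Omega> g1 \<epsilon> y1" "weak_solution \<Omega> g2 \<epsilon> y2"
    and g: "(\<lambda>x. g1 (y1 x)) \<in> product_space (L2 \<Omega>)" "(\<lambda>x. g2 (y2 x)) \<in> product_space (L2 \<Omega>)"
    and \<epsilon>: "\<epsilon> \<in> product_space (L2 \<Omega>)"
    and v: "v \<in> product_space (H10 \<Omega>)"
  shows "(\<Sum>i\<in>UNIV. \<Sum>j\<in>UNIV. LINT x|lebesgue_on \<Omega>.
        weak_partial \<Omega> j (\<lambda>x. (y1 x - y2 x) $ i) x * weak_partial \<Omega> j (\<lambda>x. v x $ i) x)
      = (\<Sum>i\<in>UNIV. LINT x|lebesgue_on \<Omega>. v x $ i * (g2 (y2 x) - g1 (y1 x)) $ i)"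
proof -
  have y: "(\<lambda>x. y1 x $ i) \<in> Hm (Suc 0) \<Omega>" "(\<lambda>x. y2 x $ i) \<in> Hm (Suc 0) \<Omega>"
    and v1: "(\<lambda>x. v x $ i) \<in> Hm (Suc 0) \<Omega>" for i
    using sol v by (auto simp: weak_solution_def Y_space_def product_space_def H10_def)
  then have v0: "(\<lambda>x. v x $ i) \<in> L2 \<Omega>" for i using Hm_subset_L2 by blast
  have data: "(\<lambda>x. \<epsilon> x $ i - g1 (y1 x) $ i) \<in> L2 \<Omega>" "(\<lambda>x. \<epsilon> x $ i - g2 (y2 x) $ i) \<in> L2 \<Omega>" for i
    using g \<epsilon> by (auto simp: product_space_def intro: L2_diff)
  note wp = weak_partial_in_L2[OF assms(1) y(1)] weak_partial_in_L2[OF assms(1) y(2)]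
    weak_partial_in_L2[OF assms(1) v1]
  have "(LINT x|lebesgue_on \<Omega>. weak_partial \<Omega> j (\<lambda>x. (y1 x - y2 x) $ i) x * weak_partial \<Omega> j (\<lambda>x. v x $ i) x)
      = (LINT x|lebesgue_on \<Omega>. weak_partial \<Omega> j (\<lambda>x. y1 x $ i) x * weak_partial \<Omega> j (\<lambda>x. v x $ i) x)
        - (LINT x|lebesgue_on \<Omega>. weak_partial \<Omega> j (\<lambda>x. y2 x $ i) x * weak_partial \<Omega> j (\<lambda>x. v x $ i) x)" for i j
  proof -
    have "(LINT x|lebesgue_on \<Omega>. weak_partial \<Omega> j (\<lambda>x. (y1 x - y2 x) $ i) x * weak_partial \<Omega> j (\<lambda>x. v x $ i) x)
      = (LINT x|lebesgue_on \<Omega>. weak_partial \<Omega> j (\<lambda>x. y1 x $ i) x * weak_partial \<Omega> j (\<lambda>x. v x $ i) x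
        - weak_partial \<Omega> j (\<lambda>x. y2 x $ i) x * weak_partial \<Omega> j (\<lambda>x. v x $ i) x)"
    proof (rule integral_cong_AE)
      note [measurable] = wp[THEN L2_measurable]
        L2_measurable[OF weak_partial_in_L2[OF assms(1) Hm_diff[OF assms(1) y]]]
      show "(\<lambda>x. weak_partial \<Omega> j (\<lambda>x. (y1 x - y2 x) $ i) x * weak_partial \<Omega> j (\<lambda>x. v x $ i) x)
          \<in> borel_measurable (lebesgue_on \<Omega>)" unfolding vector_minus_component by measurable
      show "AE x in lebesgue_on \<Omega>.
          weak_partial \<Omega> j (\<lambda>x. (y1 x - y2 x) $ i) x * weak_partial \<Omega> j (\<lambda>x. v x $ i) x
          = weak_partial \<Omega> j (\<lambda>x. y1 x $ i) x * weak_partial \<Omega> j (\<lambda>x. v x $ i) x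
          - weak_partial \<Omega> j (\<lambda>x. y2 x $ i) x * weak_partial \<Omega> j (\<lambda>x. v x $ i) x"
        using weak_partial_diff_AE[OF assms(1) y, of j i i]
        by eventually_elim (simp add: left_diff_distrib)
    qed (intro borel_measurable_diff borel_measurable_times wp[THEN L2_measurable])
    then show ?thesis
      by (simp only: Bochner_Integration.integral_diff L2_mult_integrable wp)
  qed
  moreover have "(LINT x|lebesgue_on \<Omega>. v x $ i * (g2 (y2 x) - g1 (y1 x)) $ i)
      = (LINT x|lebesgue_on \<Omega>. v x $ i * (\<epsilon> x $ i - g1 (y1 x) $ i))
        - (LINT x|lebesgue_on \<Omega>. v x $ i * (\<epsilon> x $ i - g2 (y2 x) $ i))" for i
  proof -
    have "v x $ i * (g2 (y2 x) - g1 (y1 x)) $ i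
        = v x $ i * (\<epsilon> x $ i - g1 (y1 x) $ i) - v x $ i * (\<epsilon> x $ i - g2 (y2 x) $ i)" for x
      by (simp add: algebra_simps)
    then show ?thesis
      by (simp only: Bochner_Integration.integral_diff L2_mult_integrable v0 data)
  qed
  ultimately show ?thesis
    using weak_solution_componentwise[OF assms(1) sol(1) g(1) \<epsilon> v]
      weak_solution_componentwise[OF assms(1) sol(2) g(2) \<epsilon> v]
    by (simp only: sum_subtractf)
qed

text \<open>
  Testing with one component at a time decouples the system, so that the scalar lemma on
  \<open>- \<Delta> u = r\<close> applies to each component of the difference; the control \<open>\<epsilon>\<close> cancels.
\<close>

lemma laplacian_of_difference:
  assumes "open \<Omega>" and sol: "weak_solution \<Omega> g1 \<epsilon> y1" "weak_solution \<Omega> g2 \<epsilon> y2"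
    and g: "(\<lambda>x. g1 (y1 x)) \<in> product_space (L2 \<Omega>)" "(\<lambda>x. g2 (y2 x)) \<in> product_space (L2 \<Omega>)"
    and \<epsilon>: "\<epsilon> \<in> product_space (L2 \<Omega>)"
  shows "AE x in lebesgue_on \<Omega>. weak_laplacian \<Omega> (\<lambda>x. y1 x - y2 x) x = g1 (y1 x) - g2 (y2 x)"
proof -
  define h where "h x = g2 (y2 x) - g1 (y1 x)" for x
  define y where "y x = y1 x - y2 x" for x
  have y2: "(\<lambda>x. y x $ i) \<in> Hm 2 \<Omega>" for i
    using sol unfolding y_def vector_minus_component
    by (intro Hm_diff assms(1)) (auto simp: weak_solution_def Y_space_def product_space_def)
  then have wp_y: "weak_partial \<Omega> j (\<lambda>x. y x $ i) \<in> L2 \<Omega>" for i j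
    using weak_partial_in_L2[OF assms(1), of _ "Suc 0"] by (simp add: numeral_2_eq_2)
  have h: "(\<lambda>x. h x $ i) \<in> L2 \<Omega>" for i
    using g by (auto simp: h_def product_space_def intro: L2_diff)
  have "AE x in lebesgue_on \<Omega>.
      - (\<Sum>j\<in>UNIV. weak_partial \<Omega> j (weak_partial \<Omega> j (\<lambda>x. y x $ i)) x) = h x $ i" for i
  proof (rule weak_poisson_imp_strong[OF assms(1) y2 h])
    fix \<psi> assume \<psi>: "\<psi> \<in> test_functions \<Omega>"
    define v where "v x = axis i (\<psi> x)" for x
    have v: "(\<lambda>x. v x $ k) = (if k = i then \<psi> else (\<lambda>x. 0))" for k
      by (auto simp: v_def axis_def)
    have v_test: "(\<lambda>x. v x $ k) \<in> test_functions \<Omega>" for k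
      using \<psi> by (simp add: v test_functions_0)
    then have "v \<in> product_space (H10 \<Omega>)"
      using test_function_H10[OF assms(1)] by (simp add: product_space_def)
    note eq = weak_solution_difference[OF assms(1) sol g \<epsilon> this, folded y_def h_def]
    have "(LINT x|lebesgue_on \<Omega>. weak_partial \<Omega> j (\<lambda>x. y x $ k) x * weak_partial \<Omega> j (\<lambda>x. v x $ k) x)
        = (LINT x|lebesgue_on \<Omega>. weak_partial \<Omega> j (\<lambda>x. y x $ k) x * partial j (\<lambda>x. v x $ k) x)" for j k
    proof (rule integral_cong_AE)
      note [measurable] = L2_measurable[OF wp_y] L2_measurable[OF weak_partial_in_L2[OF assms(1)
          test_function_Hm[OF assms(1) v_test]]] test_functions_measurable[OF test_functions_partial[OF v_test]]
      show "(\<lambda>x. weak_partial \<Omega> j (\<lambda>x. y x $ k) x * weak_partial \<Omega> j (\<lambda>x. v x $ k) x)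
          \<in> borel_measurable (lebesgue_on \<Omega>)"
        "(\<lambda>x. weak_partial \<Omega> j (\<lambda>x. y x $ k) x * partial j (\<lambda>x. v x $ k) x)
          \<in> borel_measurable (lebesgue_on \<Omega>)" by measurable
      show "AE x in lebesgue_on \<Omega>.
          weak_partial \<Omega> j (\<lambda>x. y x $ k) x * weak_partial \<Omega> j (\<lambda>x. v x $ k) x
          = weak_partial \<Omega> j (\<lambda>x. y x $ k) x * partial j (\<lambda>x. v x $ k) x"
        using weak_partial_test_function_AE[OF assms(1) v_test[of k], of j] by eventually_elim simp
    qed
    also have "\<dots> j k = (if k = i then
        LINT x|lebesgue_on \<Omega>. weak_partial \<Omega> j (\<lambda>x. y x $ i) x * partial j \<psi> x else 0)" for j k
      by (simp add: v partial_const)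
    finally have "(\<Sum>k\<in>UNIV. \<Sum>j\<in>UNIV. LINT x|lebesgue_on \<Omega>.
          weak_partial \<Omega> j (\<lambda>x. y x $ k) x * weak_partial \<Omega> j (\<lambda>x. v x $ k) x)
        = (\<Sum>j\<in>UNIV. LINT x|lebesgue_on \<Omega>. weak_partial \<Omega> j (\<lambda>x. y x $ i) x * partial j \<psi> x)"
      by (simp add: sum.swap[of _ UNIV UNIV])
    moreover have "(LINT x|lebesgue_on \<Omega>. v x $ k * h x $ k)
        = (if k = i then LINT x|lebesgue_on \<Omega>. h x $ i * \<psi> x else 0)" for k
      by (simp add: v_def axis_def mult.commute)
    ultimately show "(\<Sum>j\<in>UNIV. LINT x|lebesgue_on \<Omega>. weak_partial \<Omega> j (\<lambda>x. y x $ i) x * partial j \<psi> x)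
        = (LINT x|lebesgue_on \<Omega>. h x $ i * \<psi> x)"
      using eq by simp
  qed
  then have "AE x in lebesgue_on \<Omega>. \<forall>i\<in>UNIV.
      - (\<Sum>j\<in>UNIV. weak_partial \<Omega> j (weak_partial \<Omega> j (\<lambda>x. y x $ i)) x) = h x $ i"
    by (intro AE_finite_allI) auto
  then show ?thesis
    unfolding y_def[symmetric]
  proof eventually_elim
    case (elim x)
    have "weak_laplacian \<Omega> y x $ i = - h x $ i" for i
      unfolding weak_laplacian_def vec_lambda_beta using bspec[OF elim, of i] by simp
    then show ?case by (simp add: vec_eq_iff h_def)
  qed
qed

lemma norm_square_eq_sum: "(norm (z::real^'n::finite))\<^sup>2 = (\<Sum>i\<in>UNIV. (z $ i)\<^sup>2)"
  unfolding power2_norm_eq_inner inner_vec_def by (simp add: power2_eq_square)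

lemma L2_vector_norm_square:
  assumes "\<And>i. (\<lambda>x. z x $ i) \<in> L2 \<Omega>"
  shows "integrable (lebesgue_on \<Omega>) (\<lambda>x. (norm (z x))\<^sup>2)"
    and "(LINT x|lebesgue_on \<Omega>. (norm (z x))\<^sup>2) = (\<Sum>i\<in>UNIV. (L2_norm \<Omega> (\<lambda>x. z x $ i))\<^sup>2)"
  unfolding norm_square_eq_sum
  using L2_square_integrable[OF assms] by (simp_all add: L2_norm_square)

lemma Y_norm_square_of_difference:
  assumes "open \<Omega>" and sol: "weak_solution \<Omega> g1 \<epsilon> y1" "weak_solution \<Omega> g2 \<epsilon> y2"
    and g: "(\<lambda>x. g1 (y1 x)) \<in> product_space (L2 \<Omega>)" "(\<lambda>x. g2 (y2 x)) \<in> product_space (L2 \<Omega>)"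
    and \<epsilon>: "\<epsilon> \<in> product_space (L2 \<Omega>)"
  shows "(Y_norm \<Omega> (\<lambda>x. y1 x - y2 x))\<^sup>2 = (LINT x|lebesgue_on \<Omega>. (norm (g1 (y1 x) - g2 (y2 x)))\<^sup>2)"
  unfolding Y_norm_def L2_norm_square
proof (rule integral_cong_AE)
  have y2: "(\<lambda>x. (y1 x - y2 x) $ i) \<in> Hm (Suc (Suc 0)) \<Omega>" for i
    using sol unfolding vector_minus_component numeral_2_eq_2[symmetric]
    by (intro Hm_diff assms(1)) (auto simp: weak_solution_def Y_space_def product_space_def)
  have "weak_partial \<Omega> j (weak_partial \<Omega> j (\<lambda>x. (y1 x - y2 x) $ i)) \<in> L2 \<Omega>" for i j
    by (rule weak_partial_in_L2[OF assms(1) Hm_weak_partial[OF assms(1) y2]])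
  then show "(\<lambda>x. (norm (weak_laplacian \<Omega> (\<lambda>x. y1 x - y2 x) x))\<^sup>2) \<in> borel_measurable (lebesgue_on \<Omega>)"
    unfolding norm_square_eq_sum weak_laplacian_def vec_lambda_beta
    by (intro borel_measurable_sum borel_measurable_power L2_measurable)
  have "(\<lambda>x. (g1 (y1 x) - g2 (y2 x)) $ i) \<in> L2 \<Omega>" for i
    using g by (auto simp: product_space_def intro: L2_diff)
  then show "(\<lambda>x. (norm (g1 (y1 x) - g2 (y2 x)))\<^sup>2) \<in> borel_measurable (lebesgue_on \<Omega>)"
    unfolding norm_square_eq_sum by (intro borel_measurable_sum borel_measurable_power L2_measurable)
  show "AE x in lebesgue_on \<Omega>. (norm (weak_laplacian \<Omega> (\<lambda>x. y1 x - y2 x) x))\<^sup>2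
      = (norm (g1 (y1 x) - g2 (y2 x)))\<^sup>2"
    using laplacian_of_difference[OF assms] by eventually_elim simp
qed

lemma continuous_bounded_composition_L2:
  fixes g :: "real^'m::finite \<Rightarrow> real^'k::finite" and y :: "real^'n::finite \<Rightarrow> real^'m"
  assumes "\<Omega> \<in> lmeasurable" and y: "\<And>i. (\<lambda>x. y x $ i) \<in> L2 \<Omega>"
    and "continuous_on UNIV g" and B: "\<And>z. norm (g z) \<le> B"
  shows "(\<lambda>x. g (y x) $ i) \<in> L2 \<Omega>"
proof (rule L2_bounded[OF assms(1)])
  have "y \<in> borel_measurable (lebesgue_on \<Omega>)"
  proof (subst borel_measurable_euclidean_space, rule ballI)
    fix b :: "real^'m" assume "b \<in> Basis"
    then obtain i where "b = axis i 1" by (auto simp: Basis_vec_def)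
    then show "(\<lambda>x. y x \<bullet> b) \<in> borel_measurable (lebesgue_on \<Omega>)"
      using L2_measurable[OF y] by (simp add: inner_axis)
  qed
  moreover have "(\<lambda>z. g z $ i) \<in> borel_measurable borel"
    using assms(3) by (intro borel_measurable_continuous_onI continuous_intros)
  ultimately show "(\<lambda>x. g (y x) $ i) \<in> borel_measurable (lebesgue_on \<Omega>)"
    by (rule measurable_compose)
  show "\<bar>g (y x) $ i\<bar> \<le> B" for x
    using component_le_norm_cart[of "g (y x)" i] B[of "y x"] by linarith
qed

text \<open>
  The Laplacian of \<open>y = y1 - y2\<close> is \<open>(g1(y1) - g1(y2)) + (g1(y2) - g2(y2))\<close>.  The second bracket is
  at most \<open>D\<close>, the first at most \<open>\<Lambda> |y|\<close>, so it remains to bound \<open>y\<close> in \<open>L\<^sup>2\<close>.  For this, test the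
  difference of the equations with \<open>y\<close> itself: monotonicity of \<open>g1\<close> lets its contribution be dropped,
  and what is left, \<open>\<integral> |\<nabla> y|\<^sup>2 \<le> D \<integral> |y|\<close>, is closed by the Poincare inequality.  Products are split by
  \<open>2 a b \<le> a\<^sup>2 + b\<^sup>2\<close> throughout, so only integrals of squares have to be compared.
\<close>

theorem weak_solution_stability:
  fixes g1 g2 :: "real^2 \<Rightarrow> real^2"
  assumes "open \<Omega>" and R: "R > 0" "\<And>x. x \<in> \<Omega> \<Longrightarrow> norm x \<le> R"
    and cont: "continuous_on UNIV g1" "continuous_on UNIV g2"
    and bounded: "\<And>z. norm (g1 z) \<le> B1" "\<And>z. norm (g2 z) \<le> B2"
    and mono: "\<And>z z'. (g1 z - g1 z') \<bullet> (z - z') \<ge> 0"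
    and lipschitz: "\<And>z z'. norm (g1 z - g1 z') \<le> \<Lambda> * norm (z - z')"
    and close: "\<And>z. norm (g1 z - g2 z) \<le> D"
    and sol: "weak_solution \<Omega> g1 \<epsilon> y1" "weak_solution \<Omega> g2 \<epsilon> y2"
    and \<epsilon>: "\<epsilon> \<in> product_space (L2 \<Omega>)"
  shows "(Y_norm \<Omega> (\<lambda>x. y1 x - y2 x))\<^sup>2
    \<le> 2 * D\<^sup>2 * measure lebesgue \<Omega> * (1 + (16 * R\<^sup>2 * \<Lambda>)\<^sup>2)"
proof -
  define y where "y x = y1 x - y2 x" for x
  define h where "h x = g2 (y2 x) - g1 (y1 x)" for x
  define P where "P = 16 * R\<^sup>2"
  define \<mu> where "\<mu> = measure lebesgue \<Omega>"
  have P: "P > 0" using R by (simp add: P_def)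
  have "bounded \<Omega>" using R(2) by (auto simp: bounded_iff)
  then have \<Omega>: "\<Omega> \<in> lmeasurable" using assms(1) by (rule lmeasurable_open)
  interpret finite_measure "lebesgue_on \<Omega>" using \<Omega> by (rule finite_measure_lebesgue_on)
  have \<mu>: "measure (lebesgue_on \<Omega>) \<Omega> = \<mu>"
    using \<Omega> by (simp add: \<mu>_def measure_restrict_space fmeasurableD)
  have y12: "(\<lambda>x. y1 x $ i) \<in> H10 \<Omega>" "(\<lambda>x. y2 x $ i) \<in> H10 \<Omega>" for i
    using sol by (auto simp: weak_solution_def Y_space_def product_space_def)
  then have y12_L2: "(\<lambda>x. y1 x $ i) \<in> L2 \<Omega>" "(\<lambda>x. y2 x $ i) \<in> L2 \<Omega>" for i
    by (auto simp: H10_def)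
  have g: "(\<lambda>x. g1 (y1 x)) \<in> product_space (L2 \<Omega>)" "(\<lambda>x. g2 (y2 x)) \<in> product_space (L2 \<Omega>)"
    using continuous_bounded_composition_L2[OF \<Omega> y12_L2(1) cont(1) bounded(1)]
      continuous_bounded_composition_L2[OF \<Omega> y12_L2(2) cont(2) bounded(2)]
    by (auto simp: product_space_def)
  have y_H10: "(\<lambda>x. y x $ i) \<in> H10 \<Omega>" for i
    using H10_diff[OF assms(1) y12] by (simp add: y_def)
  then have y_L2: "(\<lambda>x. y x $ i) \<in> L2 \<Omega>" for i by (auto simp: H10_def)
  have h_L2: "(\<lambda>x. h x $ i) \<in> L2 \<Omega>" for i
    using g by (auto simp: h_def product_space_def intro: L2_diff)
  note y_int = L2_vector_norm_square[of y, OF y_L2] and h_int = L2_vector_norm_square[of h, OF h_L2]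
  define Iy where "Iy = (LINT x|lebesgue_on \<Omega>. (norm (y x))\<^sup>2)"
  have energy: "(\<Sum>i\<in>UNIV. \<Sum>j\<in>UNIV. (L2_norm \<Omega> (weak_partial \<Omega> j (\<lambda>x. y x $ i)))\<^sup>2)
      = (LINT x|lebesgue_on \<Omega>. y x \<bullet> h x)"
  proof -
    have "y \<in> product_space (H10 \<Omega>)" using y_H10 by (simp add: product_space_def)
    note eq = weak_solution_difference[OF assms(1) sol g \<epsilon> this, folded y_def h_def]
    moreover have "(LINT x|lebesgue_on \<Omega>. y x \<bullet> h x)
        = (\<Sum>i\<in>UNIV. LINT x|lebesgue_on \<Omega>. y x $ i * h x $ i)"
      unfolding inner_vec_def inner_real_def
      by (simp only: Bochner_Integration.integral_sum L2_mult_integrable y_L2 h_L2)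
    ultimately show ?thesis
      unfolding L2_norm_square real_norm_def power2_abs by (simp add: power2_eq_square)
  qed
  have "Iy \<le> P * (LINT x|lebesgue_on \<Omega>. y x \<bullet> h x)"
  proof -
    have "Iy = (\<Sum>i\<in>UNIV. (L2_norm \<Omega> (\<lambda>x. y x $ i))\<^sup>2)" unfolding Iy_def by (rule y_int(2))
    also have "\<dots> \<le> (\<Sum>i\<in>UNIV. P * (\<Sum>j\<in>UNIV. (L2_norm \<Omega> (weak_partial \<Omega> j (\<lambda>x. y x $ i)))\<^sup>2))"
    proof (rule sum_mono)
      fix i :: 2
      have "(L2_norm \<Omega> (\<lambda>x. y x $ i))\<^sup>2 \<le> P * (L2_norm \<Omega> (weak_partial \<Omega> 1 (\<lambda>x. y x $ i)))\<^sup>2"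
        unfolding P_def by (rule poincare_inequality[OF assms(1) R(2) y_H10])
      also have "\<dots> \<le> P * (\<Sum>j\<in>UNIV. (L2_norm \<Omega> (weak_partial \<Omega> j (\<lambda>x. y x $ i)))\<^sup>2)"
        using P by (intro mult_left_mono member_le_sum) auto
      finally show "(L2_norm \<Omega> (\<lambda>x. y x $ i))\<^sup>2
        \<le> P * (\<Sum>j\<in>UNIV. (L2_norm \<Omega> (weak_partial \<Omega> j (\<lambda>x. y x $ i)))\<^sup>2)" .
    qed
    finally show ?thesis by (simp only: sum_distrib_left[symmetric] energy)
  qed
  also have "(LINT x|lebesgue_on \<Omega>. y x \<bullet> h x)
      \<le> (LINT x|lebesgue_on \<Omega>. (norm (y x))\<^sup>2 / (2 * P) + P * D\<^sup>2 / 2)"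
  proof (rule integral_mono)
    show "integrable (lebesgue_on \<Omega>) (\<lambda>x. y x \<bullet> h x)"
      unfolding inner_vec_def inner_real_def
      by (intro Bochner_Integration.integrable_sum L2_mult_integrable y_L2 h_L2)
    show "integrable (lebesgue_on \<Omega>) (\<lambda>x. (norm (y x))\<^sup>2 / (2 * P) + P * D\<^sup>2 / 2)"
      using y_int(1) by simp
    fix x
    have "h x = (g2 (y2 x) - g1 (y2 x)) - (g1 (y1 x) - g1 (y2 x))" by (simp add: h_def)
    then have "y x \<bullet> h x = y x \<bullet> (g2 (y2 x) - g1 (y2 x)) - (g1 (y1 x) - g1 (y2 x)) \<bullet> (y1 x - y2 x)"
      by (simp only: y_def inner_diff_right inner_commute)
    also have "\<dots> \<le> y x \<bullet> (g2 (y2 x) - g1 (y2 x))" using mono[of "y1 x" "y2 x"] by simp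
    also have "\<dots> \<le> norm (y x) * norm (g2 (y2 x) - g1 (y2 x))" by (rule norm_cauchy_schwarz)
    also have "\<dots> \<le> norm (y x) * D"
      using close[of "y2 x"] by (intro mult_left_mono) (auto simp: norm_minus_commute)
    \<comment> \<open>The weights are those for which the first summand, multiplied by the
      Poincare constant \<open>P\<close>, becomes half of \<open>(norm (y x))\<^sup>2\<close> and can be absorbed.\<close>
    also have "\<dots> \<le> (norm (y x))\<^sup>2 / (2 * P) + P * D\<^sup>2 / 2"
    proof -
      have "0 \<le> (norm (y x) - P * D)\<^sup>2" by simp
      then have "2 * P * (norm (y x) * D) \<le> (norm (y x))\<^sup>2 + P\<^sup>2 * D\<^sup>2"
        by (simp add: power2_eq_square algebra_simps)
      then show ?thesis using P by (simp add: field_simps power2_eq_square)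
    qed
    finally show "y x \<bullet> h x \<le> (norm (y x))\<^sup>2 / (2 * P) + P * D\<^sup>2 / 2" .
  qed
  also have "\<dots> = Iy / (2 * P) + P * D\<^sup>2 / 2 * \<mu>"
    using y_int(1) by (simp add: Iy_def \<mu>)
  also have "P * (Iy / (2 * P) + P * D\<^sup>2 / 2 * \<mu>) = Iy / 2 + P\<^sup>2 * D\<^sup>2 * \<mu> / 2"
    using P by (simp add: field_simps power2_eq_square)
  finally have Iy: "Iy \<le> P\<^sup>2 * D\<^sup>2 * \<mu>" using P by simp
  have "(Y_norm \<Omega> (\<lambda>x. y1 x - y2 x))\<^sup>2 = (LINT x|lebesgue_on \<Omega>. (norm (h x))\<^sup>2)"
    using Y_norm_square_of_difference[OF assms(1) sol g \<epsilon>] by (simp add: h_def norm_minus_commute)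
  also have "\<dots> \<le> (LINT x|lebesgue_on \<Omega>. 2 * D\<^sup>2 + 2 * \<Lambda>\<^sup>2 * (norm (y x))\<^sup>2)"
  proof (rule integral_mono[OF h_int(1)])
    show "integrable (lebesgue_on \<Omega>) (\<lambda>x. 2 * D\<^sup>2 + 2 * \<Lambda>\<^sup>2 * (norm (y x))\<^sup>2)"
      using y_int(1) by simp
    fix x
    have "h x = - ((g1 (y2 x) - g2 (y2 x)) + (g1 (y1 x) - g1 (y2 x)))" by (simp add: h_def)
    then have "norm (h x) \<le> norm (g1 (y2 x) - g2 (y2 x)) + norm (g1 (y1 x) - g1 (y2 x))"
      by (simp only: norm_minus_cancel norm_triangle_ineq)
    also have "\<dots> \<le> D + \<Lambda> * norm (y x)"
      unfolding y_def by (intro add_mono close lipschitz)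
    finally have "(norm (h x))\<^sup>2 \<le> (D + \<Lambda> * norm (y x))\<^sup>2" by (intro power_mono) auto
    moreover have "0 \<le> (D - \<Lambda> * norm (y x))\<^sup>2" by simp
    ultimately show "(norm (h x))\<^sup>2 \<le> 2 * D\<^sup>2 + 2 * \<Lambda>\<^sup>2 * (norm (y x))\<^sup>2"
      by (simp add: power2_eq_square algebra_simps)
  qed
  also have "\<dots> = 2 * D\<^sup>2 * \<mu> + 2 * \<Lambda>\<^sup>2 * Iy"
    using y_int(1) by (simp add: Iy_def \<mu>)
  also have "\<dots> \<le> 2 * D\<^sup>2 * \<mu> + 2 * \<Lambda>\<^sup>2 * (P\<^sup>2 * D\<^sup>2 * \<mu>)"
    using Iy by (intro add_left_mono mult_left_mono) auto
  also have "\<dots> = 2 * D\<^sup>2 * \<mu> * (1 + (P * \<Lambda>)\<^sup>2)"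
    by (simp add: algebra_simps power_mult_distrib)
  finally show ?thesis unfolding \<mu>_def P_def .
qed

text \<open>
  The radius may depend on the point, but the constant may not; along a segment, the estimate can
  therefore be continued step by step from one end to the other without loss.
\<close>

lemma pointwise_lipschitz_imp_lipschitz:
  fixes f :: "'a::real_normed_vector \<Rightarrow> 'b::real_normed_vector"
  assumes "continuous_on UNIV f"
    and local: "\<And>y. \<exists>r>0. \<forall>y'. (norm (y' - y))\<^sup>2 < r \<longrightarrow> norm (f y - f y') \<le> L * norm (y - y')"
  shows "norm (f b - f a) \<le> L * norm (b - a)"
proof -
  define p where "p t = f (a + t *\<^sub>R (b - a))" for t :: real
  have "dist (p 1) (p 0) \<le> L * norm (b - a) * (1 - 0)"
  proof (rule locally_lipschitz_imp_lipschitz_aux)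
    show "continuous_on {0..1} p"
      unfolding p_def
      by (rule continuous_on_compose2[OF assms(1)]) (auto intro!: continuous_intros)
    fix x :: real assume x: "x \<in> {0..<1}"
    obtain r where r: "r > 0" "\<And>y'. (norm (y' - (a + x *\<^sub>R (b - a))))\<^sup>2 < r \<Longrightarrow>
        norm (f (a + x *\<^sub>R (b - a)) - f y') \<le> L * norm (a + x *\<^sub>R (b - a) - y')"
      using local[of "a + x *\<^sub>R (b - a)"] by blast
    define s where "s = min (1 - x) (sqrt r / (norm (b - a) + 1))"
    have s: "0 < s" "s \<le> 1 - x" "s \<le> sqrt r / (norm (b - a) + 1)"
      using x r(1) by (auto simp: s_def add_nonneg_pos)
    have diff: "a + (x + s) *\<^sub>R (b - a) - (a + x *\<^sub>R (b - a)) = s *\<^sub>R (b - a)"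
      by (simp add: algebra_simps)
    have "s * norm (b - a) < s * (norm (b - a) + 1)" using s(1) by simp
    also have "\<dots> \<le> sqrt r" using s(3) by (simp add: pos_le_divide_eq add_nonneg_pos)
    finally have "(s * norm (b - a))\<^sup>2 < (sqrt r)\<^sup>2" using s(1) by (intro power_strict_mono) auto
    then have "(norm (a + (x + s) *\<^sub>R (b - a) - (a + x *\<^sub>R (b - a))))\<^sup>2 < r"
      unfolding diff using s(1) r(1) by (simp add: less_imp_le)
    from r(2)[OF this] have "dist (p (x + s)) (p x) \<le> L * norm (b - a) * (x + s - x)"
      unfolding norm_minus_commute[of "a + x *\<^sub>R (b - a)"] diff
      using s(1) by (simp add: p_def dist_norm norm_minus_commute mult.assoc mult.commute[of s])
    then show "\<exists>y\<in>{x<..1}. dist (p y) (p x) \<le> L * norm (b - a) * (y - x)"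
      using s by (intro bexI[of _ "x + s"]) auto
  qed simp
  then show ?thesis by (simp add: p_def dist_norm)
qed

section \<open>Dependence on the coefficients\<close>

lemma nonlinearity_diff:
  "nonlinearity K \<phi> \<alpha> y - nonlinearity K \<phi> \<beta> y = nonlinearity K \<phi> (\<lambda>j. \<alpha> j - \<beta> j) y"
  by (simp add: nonlinearity_def scaleR_diff_left sum_subtractf)

text \<open>
  Only the first \<open>k\<close> coefficients contribute, which is the source of the factor \<open>k\<close>.  The offset \<open>c\<close>
  is zero when the nonlinearity itself is bounded, and the value of \<open>\<phi> j\<close> at a second point when its
  increments are.
\<close>

lemma norm_nonlinearity_le:
  assumes "k \<le> K" and \<alpha>: "\<And>j. j \<in> {1..K} \<Longrightarrow> \<bar>\<alpha> j\<bar> \<le> a" "\<And>j. j \<in> {k+1..K} \<Longrightarrow> \<alpha> j = 0"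
    and M: "\<And>j. j \<in> {1..K} \<Longrightarrow> norm (\<phi> j y - c j) \<le> M"
  shows "norm (\<Sum>j=1..K. \<alpha> j *\<^sub>R (\<phi> j y - c j)) \<le> real k * a * M"
proof -
  have "(\<Sum>j=1..K. \<alpha> j *\<^sub>R (\<phi> j y - c j)) = (\<Sum>j=1..k. \<alpha> j *\<^sub>R (\<phi> j y - c j))"
    using assms(1) \<alpha>(2) by (intro sum.mono_neutral_right) auto
  also have "norm \<dots> \<le> (\<Sum>j=1..k. a * M)"
  proof (rule sum_norm_le)
    fix j assume "j \<in> {1..k}"
    then have "j \<in> {1..K}" using assms(1) by auto
    then have "\<bar>\<alpha> j\<bar> * norm (\<phi> j y - c j) \<le> a * M"
      using \<alpha>(1)[of j] M[of j] by (intro mult_mono) auto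
    then show "norm (\<alpha> j *\<^sub>R (\<phi> j y - c j)) \<le> a * M" by simp
  qed
  also have "\<dots> = real k * a * M" by simp
  finally show ?thesis .
qed

text \<open>The weight \<open>g\<close> is constant for bounds on the basis functions, and a distance for Lipschitz bounds.\<close>

lemma uniform_bound:
  assumes "finite J" "\<forall>j\<in>J. \<exists>b::real. \<forall>x. f j x \<le> b * g j x" "\<And>j x. 0 \<le> g j x"
  shows "\<exists>b\<ge>0. \<forall>j\<in>J. \<forall>x. f j x \<le> b * g j x"
proof -
  obtain b where b: "\<And>j x. j \<in> J \<Longrightarrow> f j x \<le> b j * g j x" using assms(2) by metis
  have "f j x \<le> (\<Sum>j\<in>J. \<bar>b j\<bar>) * g j x" if "j \<in> J" for j x
  proof -
    have "b j \<le> (\<Sum>j\<in>J. \<bar>b j\<bar>)"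
      using member_le_sum[of j J "\<lambda>j. \<bar>b j\<bar>"] that assms(1) by auto
    with b[OF that, of x] assms(3)[of j x] show ?thesis
      by (meson mult_right_mono order_trans)
  qed
  moreover have "0 \<le> (\<Sum>j\<in>J. \<bar>b j\<bar>)" by (simp add: sum_nonneg)
  ultimately show ?thesis by blast
qed

theorem theorem3p11:
  fixes \<Omega> :: "(real^2) set"
    and K k :: nat
    and \<phi> :: "nat \<Rightarrow> real^2 \<Rightarrow> real^2"
    and \<alpha>max :: real
    and \<epsilon>a \<epsilon>b :: "real^2"
    and \<epsilon> :: "real^2 \<Rightarrow> real^2"
  assumes "open \<Omega>" "\<Omega> \<noteq> {}" "\<Omega> \<subset> UNIV" "bounded \<Omega>" "convex \<Omega>" "lipschitz_boundary \<Omega>"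
    and "\<epsilon>a \<le> \<epsilon>b"
    and "\<alpha>max \<ge> 0"
    and "lin_indep_family K \<phi>"
    and "\<forall>j\<in>{1..K}. Ck 1 (\<phi> j)"
    and "\<forall>j\<in>{1..K}. \<exists>L>0. \<forall>y. \<exists>r>0. \<forall>y'. (norm (y' - y))\<^sup>2 < r \<longrightarrow>
           norm (\<phi> j y - \<phi> j y') \<le> L * norm (y - y')"
    and "\<forall>j\<in>{1..K}. \<exists>c C :: real^2. (\<forall>i. 0 < c $ i \<and> c $ i < C $ i) \<and>
           (\<forall>y. c \<le> \<phi> j y \<and> \<phi> j y \<le> C)"
    and "\<forall>j\<in>{1..K}. \<forall>y y'. (\<phi> j y - \<phi> j y') \<bullet> (y - y') \<ge> 0"
    and "\<forall>\<alpha>\<in>coeff_set K \<alpha>max K. Ck 1 (nonlinearity K \<phi> \<alpha>) \<and>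
           (\<forall>y. pos_semidef (jacobian (nonlinearity K \<phi> \<alpha>) (at y)))"
    and "\<epsilon> \<in> admissible_controls \<Omega> \<epsilon>a \<epsilon>b"
    and "k \<in> {1..K}"
  shows "\<exists>C>0. \<forall>\<alpha>1\<in>coeff_set K \<alpha>max k. \<forall>\<alpha>2\<in>coeff_set K \<alpha>max k. \<forall>y1 y2.
           weak_solution \<Omega> (nonlinearity K \<phi> \<alpha>1) \<epsilon> y1 \<longrightarrow>
           weak_solution \<Omega> (nonlinearity K \<phi> \<alpha>2) \<epsilon> y2 \<longrightarrow>
           Y_norm \<Omega> (\<lambda>x. y1 x - y2 x) \<le> C * (real k)\<^sup>2 * max_norm K (\<lambda>j. \<alpha>1 j - \<alpha>2 j)"
proof -
  have k: "k \<le> K" "1 \<le> k" using assms(16) by auto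
  have cont: "continuous_on UNIV (\<phi> j)" if "j \<in> {1..K}" for j
    using assms(10) that Ck_continuous by blast
  obtain R where R: "R > 0" "\<And>x. x \<in> \<Omega> \<Longrightarrow> norm x \<le> R"
    using assms(4) unfolding bounded_pos by blast
  have bd: "\<forall>j\<in>{1..K}. \<exists>b. \<forall>y. norm (\<phi> j y) \<le> b * 1"
  proof
    fix j assume j: "j \<in> {1..K}"
    obtain c C :: "real^2" where c: "\<And>i. 0 < c $ i" "\<And>y. c \<le> \<phi> j y" "\<And>y. \<phi> j y \<le> C"
      using bspec[OF assms(12) j] by blast
    have "norm (\<phi> j y) \<le> norm C" for y
    proof (rule norm_le_componentwise_cart)
      fix i
      have "c $ i \<le> \<phi> j y $ i" "\<phi> j y $ i \<le> C $ i"
        using c(2,3)[of y] by (auto simp: less_eq_vec_def)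
      with c(1)[of i] show "norm (\<phi> j y $ i) \<le> norm (C $ i)" by simp
    qed
    then show "\<exists>b. \<forall>y. norm (\<phi> j y) \<le> b * 1" by auto
  qed
  obtain M where "M \<ge> 0" "\<forall>j\<in>{1..K}. \<forall>y. norm (\<phi> j y) \<le> M * 1"
    using uniform_bound[of "{1..K}" "\<lambda>j y. norm (\<phi> j y)" "\<lambda>_ _. 1", OF finite_atLeastAtMost bd
        zero_le_one] by blast
  then have M: "M \<ge> 0" "\<And>j y. j \<in> {1..K} \<Longrightarrow> norm (\<phi> j y) \<le> M"
    by auto
  have lip: "\<forall>j\<in>{1..K}. \<exists>b. \<forall>z. norm (\<phi> j (fst z) - \<phi> j (snd z)) \<le> b * norm (fst z - snd z)"
  proof
    fix j assume j: "j \<in> {1..K}"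
    obtain L where "\<And>y. \<exists>r>0. \<forall>y'. (norm (y' - y))\<^sup>2 < r \<longrightarrow>
           norm (\<phi> j y - \<phi> j y') \<le> L * norm (y - y')"
      using bspec[OF assms(11) j] by blast
    then have "norm (\<phi> j b - \<phi> j a) \<le> L * norm (b - a)" for a b
      by (rule pointwise_lipschitz_imp_lipschitz[OF cont[OF j]])
    then show "\<exists>b. \<forall>z. norm (\<phi> j (fst z) - \<phi> j (snd z)) \<le> b * norm (fst z - snd z)" by blast
  qed
  obtain L where "L \<ge> 0" and
    "\<forall>j\<in>{1..K}. \<forall>z. norm (\<phi> j (fst z) - \<phi> j (snd z)) \<le> L * norm (fst z - snd z)"
    using uniform_bound[of "{1..K}" "\<lambda>j z. norm (\<phi> j (fst z) - \<phi> j (snd z))"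
        "\<lambda>_ z. norm (fst z - snd z)", OF finite_atLeastAtMost lip norm_ge_zero] by blast
  then have L: "L \<ge> 0"
    "\<And>j z. j \<in> {1..K} \<Longrightarrow> norm (\<phi> j (fst z) - \<phi> j (snd z)) \<le> L * norm (fst z - snd z)"
    by blast+
  have \<epsilon>: "\<epsilon> \<in> product_space (L2 \<Omega>)" using assms(15) by (simp add: admissible_controls_def)
  define P where "P = 16 * R\<^sup>2"
  define C where "C = sqrt (2 * measure lebesgue \<Omega>) * M * (1 + P * \<alpha>max * L)"
  have P: "P \<ge> 0" by (simp add: P_def)
  have C: "C \<ge> 0" using M L P assms(8) by (simp add: C_def)
  have "Y_norm \<Omega> (\<lambda>x. y1 x - y2 x) \<le> (C + 1) * (real k)\<^sup>2 * max_norm K (\<lambda>j. \<alpha>1 j - \<alpha>2 j)"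
    if \<alpha>: "\<alpha>1 \<in> coeff_set K \<alpha>max k" "\<alpha>2 \<in> coeff_set K \<alpha>max k"
      and sol: "weak_solution \<Omega> (nonlinearity K \<phi> \<alpha>1) \<epsilon> y1" "weak_solution \<Omega> (nonlinearity K \<phi> \<alpha>2) \<epsilon> y2"
    for \<alpha>1 \<alpha>2 y1 y2
  proof -
    define \<delta> where "\<delta> = max_norm K (\<lambda>j. \<alpha>1 j - \<alpha>2 j)"
    have \<delta>: "\<bar>\<alpha>1 j - \<alpha>2 j\<bar> \<le> \<delta>" if "j \<in> {1..K}" for j
      unfolding \<delta>_def max_norm_def using that by (intro Max_ge) auto
    have "\<delta> \<ge> 0" using \<delta>[of k] k abs_ge_zero[of "\<alpha>1 k - \<alpha>2 k"] by (auto intro: order_trans)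
    have coeff: "\<bar>\<alpha> j\<bar> \<le> \<alpha>max" "0 \<le> \<alpha> j" "j \<in> {k+1..K} \<Longrightarrow> \<alpha> j = 0"
      if "\<alpha> \<in> coeff_set K \<alpha>max k" "j \<in> {1..K}" for \<alpha> j
      using that by (auto simp: coeff_set_def PiE_iff)
    have continuous: "continuous_on UNIV (nonlinearity K \<phi> \<alpha>)" for \<alpha>
      unfolding nonlinearity_def by (intro continuous_intros cont)
    have bounded: "norm (nonlinearity K \<phi> \<alpha> z) \<le> real k * \<alpha>max * M"
      if "\<alpha> \<in> coeff_set K \<alpha>max k" for \<alpha> z
      using norm_nonlinearity_le[OF k(1), of \<alpha> \<alpha>max \<phi> z "\<lambda>_. 0" M] coeff[OF that] M(2)
      by (auto simp: nonlinearity_def)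
    have close: "norm (nonlinearity K \<phi> \<alpha>1 z - nonlinearity K \<phi> \<alpha>2 z) \<le> real k * \<delta> * M" for z
      unfolding nonlinearity_diff using norm_nonlinearity_le[OF k(1), of "\<lambda>j. \<alpha>1 j - \<alpha>2 j" \<delta> \<phi> z "\<lambda>_. 0" M]
        \<delta> M(2) coeff[OF \<alpha>(1)] coeff[OF \<alpha>(2)]
      by (auto simp: nonlinearity_def)
    have increment: "nonlinearity K \<phi> \<alpha>1 z - nonlinearity K \<phi> \<alpha>1 z'
        = (\<Sum>j=1..K. \<alpha>1 j *\<^sub>R (\<phi> j z - \<phi> j z'))" for z z'
      by (simp add: nonlinearity_def scaleR_diff_right sum_subtractf)
    have lipschitz: "norm (nonlinearity K \<phi> \<alpha>1 z - nonlinearity K \<phi> \<alpha>1 z')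
        \<le> real k * \<alpha>max * L * norm (z - z')" for z z'
      using norm_nonlinearity_le[OF k(1), of \<alpha>1 \<alpha>max \<phi> z "\<lambda>j. \<phi> j z'" "L * norm (z - z')"]
        coeff[OF \<alpha>(1)] L(2)[of _ "(z, z')"] by (auto simp: increment mult.assoc)
    have mono: "0 \<le> (nonlinearity K \<phi> \<alpha>1 z - nonlinearity K \<phi> \<alpha>1 z') \<bullet> (z - z')" for z z'
      unfolding increment inner_sum_left inner_scaleR_left
      using coeff(2)[OF \<alpha>(1)] assms(13) by (intro sum_nonneg mult_nonneg_nonneg) auto
    have "(Y_norm \<Omega> (\<lambda>x. y1 x - y2 x))\<^sup>2
        \<le> 2 * (real k * \<delta> * M)\<^sup>2 * measure lebesgue \<Omega> * (1 + (P * (real k * \<alpha>max * L))\<^sup>2)"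
      unfolding P_def
      by (rule weak_solution_stability[OF assms(1) R continuous continuous bounded[OF \<alpha>(1)] bounded[OF \<alpha>(2)]
            mono lipschitz close sol \<epsilon>])
    \<comment> \<open>One factor \<open>k\<close> is already present in the distance of the nonlinearities; the Lipschitz constant
      contributes the second one.\<close>
    also have "\<dots> \<le> 2 * (real k * \<delta> * M)\<^sup>2 * measure lebesgue \<Omega> * (real k * (1 + P * \<alpha>max * L))\<^sup>2"
    proof (rule mult_left_mono)
      have "0 \<le> P * \<alpha>max * L" using P L assms(8) by simp
      then have "1 + (P * \<alpha>max * L)\<^sup>2 \<le> (1 + P * \<alpha>max * L)\<^sup>2" by (simp add: power2_sum)
      then have "(real k)\<^sup>2 * (1 + (P * \<alpha>max * L)\<^sup>2) \<le> (real k)\<^sup>2 * (1 + P * \<alpha>max * L)\<^sup>2"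
        by (rule mult_left_mono) simp
      moreover have "(real k)\<^sup>2 * (1 + (P * \<alpha>max * L)\<^sup>2) = (real k)\<^sup>2 + (P * (real k * \<alpha>max * L))\<^sup>2"
        by (simp add: power_mult_distrib distrib_left mult_ac)
      moreover have "1 \<le> (real k)\<^sup>2" using k by simp
      ultimately show "1 + (P * (real k * \<alpha>max * L))\<^sup>2 \<le> (real k * (1 + P * \<alpha>max * L))\<^sup>2"
        unfolding power_mult_distrib[of "real k"] by linarith
    qed simp
    also have "\<dots> = (C * (real k)\<^sup>2 * \<delta>)\<^sup>2"
      by (simp add: C_def power_mult_distrib power2_eq_square mult_ac)
    finally have "Y_norm \<Omega> (\<lambda>x. y1 x - y2 x) \<le> C * (real k)\<^sup>2 * \<delta>"
      by (rule power2_le_imp_le) (use C \<open>\<delta> \<ge> 0\<close> in simp)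
    \<comment> \<open>The shift by one makes positivity of the constant immediate.\<close>
    also have "\<dots> \<le> (C + 1) * (real k)\<^sup>2 * \<delta>"
      using \<open>\<delta> \<ge> 0\<close> by (intro mult_right_mono) auto
    finally show ?thesis unfolding \<delta>_def .
  qed
  moreover have "C + 1 > 0" using C by simp
  ultimately show ?thesis by blast
qed

end
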